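(* Let $G$ be a finite group. Then $G \cong \mathrm{PSL}(2,5)$ or $G \cong \mathbb{Z}_{30}$ if and only if $\operatorname{Exp}_{\rho}(G) = \operatorname{Exp}_{\rho}(\mathrm{PSL}(2,5))$.
   Context: For a finite group $G$, $o(g)$ denotes the order of $g\in G$ and $\rho(G)=\prod_{g\in G} o(g)$ is the product of the element orders. If $n=p_1^{\alpha_1}\cdots p_k^{\alpha_k}$ with $p_1,\dots,p_k$ distinct primes and all $\alpha_i\ge 1$, then $\operatorname{Exp}(n)=\{\alpha_1,\dots,\alpha_k\}$, regarded as a set (repetitions are not recorded, nor is which exponent belongs to which prime). Set $\operatorname{Exp}_{\rho}(G)=\operatorname{Exp}(\rho(G))$. $\mathbb{Z}_n$ denotes the cyclic group of order $n$. *)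

theory Defs
  imports
    "HOL-Algebra.Algebra"
    "HOL-Analysis.Analysis"
    "HOL-Computational_Algebra.Computational_Algebra"
begin

definition Exp :: "nat \<Rightarrow> nat set" where
  "Exp n = (\<lambda>p. multiplicity p n) ` prime_factors n"

definition prod_ord :: "('a, 'b) monoid_scheme \<Rightarrow> nat" where
  "prod_ord G = (\<Prod>g\<in>carrier G. group.ord G g)"

definition Exp_rho :: "('a, 'b) monoid_scheme \<Rightarrow> nat set" where
  "Exp_rho G = Exp (prod_ord G)"

definition group_center :: "('a, 'b) monoid_scheme \<Rightarrow> 'a set" where
  "group_center G = {z \<in> carrier G. \<forall>g\<in>carrier G. z \<otimes>\<^bsub>G\<^esub> g = g \<otimes>\<^bsub>G\<^esub> z}"

text \<open>
  The entries are only required to come from a commutative ring, because the type \<open>5\<close> of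
  integers modulo 5 (theory \<open>Numeral_Type\<close>) is an instance of \<^class>\<open>comm_ring_1\<close>
  but not of \<^class>\<open>field\<close>.
\<close>

definition SL :: "('a::comm_ring_1 ^ 'n ^ 'n) monoid" where
  "SL = \<lparr>carrier = {A. det A = 1}, monoid.mult = (**), one = mat 1\<rparr>"

definition PSL :: "('a::comm_ring_1 ^ 'n ^ 'n) set monoid" where
  "PSL = SL Mod group_center SL"

text \<open>
  Here \<open>5\<close> in \<open>5 ^ 2 ^ 2\<close> is the type of entries, the field with five elements, and
  both \<open>2\<close>s are two-element index types.
\<close>

abbreviation PSL_2_5 :: "(5 ^ 2 ^ 2) set monoid" where
  "PSL_2_5 \<equiv> PSL"

end

(*
  Write e(p) for the exponent of p in rho(G), the sum over all g of the p-adic valuation of the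
  order of g.  Sorting the elements by their p-part and applying Frobenius' theorem on the number
  of p'-elements to the centralizers shows that the p'-part of |G| divides e(p).  If the exponents
  are 15, 20 and 24, this forces the primes to be 2, 3, 5, with e(2) = 15, e(3) = 20, e(5) = 24,
  and |G| to be 30 or 60.  For |G| = 30 the elements of order prime to 2, 3 or 5 number at most
  29, so there is an element of order 30.  For |G| = 60 the exponents add up to 59, so every
  nonidentity element has prime order.  Then G acts by conjugation on the five centralizers of
  involutions, faithfully and by even permutations, so G is alternating of degree 5.  The group
  PSL(2,5) has order 60, and by Cayley-Hamilton its nonidentity elements have prime order as well.
*)
theory Submission imports Defs "HOL-Number_Theory.Cong" begin

section \<open>Primary and regular elements\<close>

text \<open>The set of exponents forgets which prime owns which exponent. What undoes this is that
  every prime divisor of |G| other than p divides e(p): the owners of 15, 20 and 24 divide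
  gcd(20,24) = 4, gcd(15,24) = 3 and gcd(15,20) = 5. The divisibility comes class by class. A
  p-element x has |G| / |C(x)| conjugates and is the p-part of as many elements as C(x) has elements
  of order prime to p. By Frobenius the p'-part of |C(x)| divides that number, so each class
  contributes a multiple of the p'-part of |G|. Frobenius' theorem itself comes from the same count
  with weight 1, by induction over subgroups. That the p'-part of a divides b is written
  \<open>a dvd p ^ k * b\<close> for some k, a form that adds up over classes without naming the
  p'-part. PSL(2,5) is not compared with G directly: order 60 and element orders 1, 2, 3, 5 alone
  force the exponents 15, 20, 24 and an isomorphism to the alternating group.\<close>

definition centralizer :: "('a, 'b) monoid_scheme \<Rightarrow> 'a \<Rightarrow> 'a set" where
  "centralizer G x = {g \<in> carrier G. g \<otimes>\<^bsub>G\<^esub> x = x \<otimes>\<^bsub>G\<^esub> g}"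

definition regular_elements :: "nat \<Rightarrow> ('a, 'b) monoid_scheme \<Rightarrow> 'a set" where
  "regular_elements p G = {y \<in> carrier G. \<not> p dvd group.ord G y}"

definition primary_elements :: "nat \<Rightarrow> ('a, 'b) monoid_scheme \<Rightarrow> 'a set" where
  "primary_elements p G = {x \<in> carrier G. \<exists>k. group.ord G x dvd p ^ k}"

lemma (in group) ord_subgroup:
  assumes "subgroup H G"
  shows "group.ord (G\<lparr>carrier := H\<rparr>) x = ord x"
proof -
  interpret H: group "G\<lparr>carrier := H\<rparr>"
    using assms by (rule subgroup_imp_group)
  show ?thesis
    unfolding ord_def H.ord_def by (simp flip: nat_pow_consistent)
qed

lemma (in group) regular_elements_subgroup:
  assumes "subgroup H G"
  shows "regular_elements p (G\<lparr>carrier := H\<rparr>) = H \<inter> regular_elements p G"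
  using subgroup.subset[OF assms] by (auto simp: regular_elements_def ord_subgroup[OF assms])

section \<open>Conjugation, centralizers and sums over orbits\<close>

lemma (in group) conj_pow:
  assumes "g \<in> carrier G" "x \<in> carrier G"
  shows "(g \<otimes> x \<otimes> inv g) [^] (n::nat) = g \<otimes> x [^] n \<otimes> inv g"
proof (induction n)
  case 0
  then show ?case using assms by simp
next
  case (Suc n)
  then show ?case using assms
    by (simp add: m_assoc) (simp flip: m_assoc)
qed

lemma (in group) conj_eq_one_iff:
  assumes "g \<in> carrier G" "x \<in> carrier G"
  shows "g \<otimes> x \<otimes> inv g = \<one> \<longleftrightarrow> x = \<one>"
  using assms by (metis inv_closed inv_solve_right' l_one m_assoc m_closed r_cancel_one' r_inv)

lemma (in group) ord_conj:
  assumes "g \<in> carrier G" "x \<in> carrier G"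
  shows "ord (g \<otimes> x \<otimes> inv g) = ord x"
  unfolding ord_def using assms by (simp add: conj_pow conj_eq_one_iff)

lemma (in group) centralizer_eq_stabilizer:
  assumes "x \<in> carrier G"
  shows "centralizer G x = stabilizer G (\<lambda>g. \<lambda>h \<in> carrier G. g \<otimes> h \<otimes> inv g) x"
  unfolding centralizer_def stabilizer_def using assms
  by (auto simp: inv_solve_right' inv_solve_right)

lemma (in group) centralizer_subgroup:
  assumes "x \<in> carrier G"
  shows "subgroup (centralizer G x) G"
  unfolding centralizer_eq_stabilizer[OF assms]
  using assms by (rule group_action.stabilizer_subgroup[OF action_by_conjugation])

text \<open>An orbit of x has |G| / |Stab(x)| points, all of weight w x. If |Stab(x)| divides N * w
  x, then |G| divides N times the weight of the orbit, and the orbits partition E. The factor N will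
  hold a power of p.\<close>

lemma (in group_action) order_dvd_sum_invariant:
  fixes w :: "'c \<Rightarrow> nat"
  assumes fin: "finite (carrier G)" "finite E"
    and inv: "\<And>g x. g \<in> carrier G \<Longrightarrow> x \<in> E \<Longrightarrow> w (\<phi> g x) = w x"
    and dvd: "\<And>x. x \<in> E \<Longrightarrow> card (stabilizer G \<phi> x) dvd N * w x"
  shows "Coset.order G dvd N * sum w E"
proof -
  have "Coset.order G dvd N * sum w A" if A: "A \<in> orbits G E \<phi>" for A
  proof -
    obtain x where x: "x \<in> E" "A = orbit G \<phi> x"
      using A by (auto simp: orbits_def)
    have "sum w A = (\<Sum>y\<in>A. w x)"
      using x inv by (intro sum.cong) (auto simp: orbit_def)
    moreover have "Coset.order G = card A * card (stabilizer G \<phi> x)"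
      using orbit_stabilizer_theorem[OF x(1)] x(2) by simp
    ultimately show ?thesis
      using mult_dvd_mono[OF dvd_refl dvd[OF x(1)], of "card A"]
      by (simp add: mult.left_commute)
  qed
  then have "Coset.order G dvd N * (\<Sum>A\<in>orbits G E \<phi>. sum w A)"
    by (subst sum_distrib_left) (intro dvd_sum)
  then show ?thesis
    using disjoint_sum[OF fin(2), of w] by simp
qed

lemma (in group) order_dvd_sum_class_function:
  fixes w :: "'a \<Rightarrow> nat"
  assumes fin: "finite (carrier G)"
    and inv: "\<And>g x. g \<in> carrier G \<Longrightarrow> x \<in> carrier G \<Longrightarrow> w (g \<otimes> x \<otimes> inv g) = w x"
    and dvd: "\<And>x. x \<in> carrier G \<Longrightarrow> card (centralizer G x) dvd N * w x"
  shows "Coset.order G dvd N * sum w (carrier G)"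
  using assms
  by (intro group_action.order_dvd_sum_invariant[OF action_by_conjugation])
    (auto simp: centralizer_eq_stabilizer)

text \<open>A Sylow p-subgroup has a nonidentity element, whose order is a power of p by Lagrange; a
  suitable power of it has order exactly p.\<close>

lemma (in group) cauchy:
  assumes "finite (carrier G)" "Factorial_Ring.prime (p::nat)" "p dvd Coset.order G"
  obtains x where "x \<in> carrier G" "ord x = p"
proof -
  define a where "a = multiplicity p (Coset.order G)"
  have pos: "Coset.order G > 0"
    using assms(1) one_closed by (auto simp: Coset.order_def card_gt_0_iff)
  have a: "a > 0"
    unfolding a_def using assms pos by (simp add: prime_multiplicity_gt_zero_iff)
  obtain m where m: "Coset.order G = p ^ a * m"
    using multiplicity_dvd[of p "Coset.order G"] unfolding a_def by (auto elim: dvdE)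
  obtain H where H: "subgroup H G" "card H = p ^ a"
    using sylow_thm[OF assms(2) _ m assms(1)] group_axioms by blast
  have "card H > 1"
    using H(2) one_less_power[OF prime_gt_1_nat[OF assms(2)] a] by simp
  then have "H \<noteq> {\<one>}" by auto
  then obtain x where x: "x \<in> H" "x \<noteq> \<one>"
    using subgroup.one_closed[OF H(1)] by blast
  then have xG: "x \<in> carrier G" using H(1) by (meson subgroup.mem_carrier)
  interpret H: group "G\<lparr>carrier := H\<rparr>"
    using H(1) by (rule subgroup_imp_group)
  have "ord x dvd p ^ a"
    using H.ord_dvd_group_order[of x] x H(2) by (simp add: ord_subgroup[OF H(1)] Coset.order_def)
  then obtain k where k: "ord x = p ^ k"
    using assms(2) by (auto simp: divides_primepow_nat)
  have "k \<noteq> 0" using k x(2) ord_eq_1[OF xG] by auto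
  then have "p dvd ord x" using k by simp
  then obtain d where d: "ord x = p * d" by (auto elim: dvdE)
  have "d \<noteq> 0" using d k prime_gt_0_nat[OF assms(2)] by (metis mult_0_right power_eq_0_iff neq0_conv)
  show ?thesis
    using that[of "x [^] d"] ord_pow[OF xG, of d] d \<open>d \<noteq> 0\<close> xG by simp
qed

text \<open>Any other prime q dividing the order would give, by \<open>cauchy\<close>, an element of
  order q, which is not a p-element.\<close>

lemma (in group) order_eq_prime_power:
  assumes fin: "finite (carrier G)" and p: "Factorial_Ring.prime (p::nat)"
    and prim: "carrier G \<subseteq> primary_elements p G"
  obtains k where "Coset.order G = p ^ k"
proof -
  have pos: "Coset.order G \<noteq> 0"
    using fin one_closed by (auto simp: Coset.order_def)
  have "q = p" if q: "q \<in> prime_factors (Coset.order G)" for q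
  proof -
    have q': "Factorial_Ring.prime q" "q dvd Coset.order G" using q by auto
    obtain x where x: "x \<in> carrier G" "ord x = q"
      using cauchy[OF fin q'] by blast
    then obtain k where "q dvd p ^ k"
      using prim by (auto simp: primary_elements_def)
    then show "q = p"
      using p q' by (meson prime_dvd_power primes_dvd_imp_eq)
  qed
  then have "prime_factors (Coset.order G) \<subseteq> {p}" by auto
  then have "Coset.order G = p ^ multiplicity p (Coset.order G)"
    using prime_factorization_nat[of "Coset.order G"] pos p
    by (metis (no_types, lifting) Factorial_Ring.not_dvd_imp_multiplicity_0 in_prime_factors_iff power_0
        prime_factors_multiplicity neq0_conv prod.empty prod.insert finite.emptyI empty_iff
        mult.right_neutral subset_singletonD)
  then show ?thesis using that by blast
qed

text \<open>Write |G| = q * m with q a power of p and m prime to p. The Chinese remainder theorem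
  gives u congruent to 1 mod q and 0 mod m, and v the other way round. One pair u, v serves all
  elements, so taking the p-part and the p'-part are fixed power maps.\<close>

lemma (in group) primary_decomposition:
  assumes fin: "finite (carrier G)" and p: "Factorial_Ring.prime (p::nat)"
  obtains u v :: nat where
    "\<And>x. x \<in> carrier G \<Longrightarrow> x [^] u \<otimes> x [^] v = x"
    "\<And>x. x \<in> carrier G \<Longrightarrow> x [^] u \<in> primary_elements p G"
    "\<And>x. x \<in> carrier G \<Longrightarrow> x [^] v \<in> regular_elements p G"
    "\<And>x. x \<in> primary_elements p G \<Longrightarrow> x [^] u = x \<and> x [^] v = \<one>"
    "\<And>x. x \<in> regular_elements p G \<Longrightarrow> x [^] u = \<one> \<and> x [^] v = x"
proof -
  have pos: "Coset.order G \<noteq> 0"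
    using fin one_closed by (auto simp: Coset.order_def)
  obtain m where m: "Coset.order G = p ^ multiplicity p (Coset.order G) * m" "\<not> p dvd m"
    using multiplicity_decompose'[of "Coset.order G" p] pos p
    by (metis not_prime_unit)
  define q where "q = p ^ multiplicity p (Coset.order G)"
  have qm: "Coset.order G = q * m" using m(1) by (simp add: q_def)
  have cop: "coprime q m"
    unfolding q_def using p m(2) by (simp add: prime_imp_coprime)
  obtain u where u: "[u = 1] (mod q)" "[u = 0] (mod m)"
    using binary_chinese_remainder_nat[OF cop, of 1 0] by blast
  obtain v where v: "[v = 0] (mod q)" "[v = 1] (mod m)"
    using binary_chinese_remainder_nat[OF cop, of 0 1] by blast
  have uv: "[u + v = 1] (mod q * m)"
    using cong_add[OF u(1) v(1)] cong_add[OF u(2) v(2)] cop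
    by (intro coprime_cong_mult_nat) auto
  have ord: "ord x dvd q * m" if "x \<in> carrier G" for x
    using ord_dvd_group_order[OF that] qm by simp
  have pow_cong: "x [^] a = x [^] b" if "x \<in> carrier G" "[a = b] (mod d)" "ord x dvd d" for x and a b d :: nat
  proof -
    have "int (ord x) dvd int b - int a"
      using that(2,3) by (meson cong_dvd_modulus_nat cong_iff_dvd_diff cong_int_iff cong_sym)
    then show ?thesis
      using int_pow_eq[OF that(1), of "int a" "int b"] by (simp add: int_pow_int)
  qed
  have prim: "ord x dvd q" if x: "x \<in> primary_elements p G" for x
  proof -
    obtain k where k: "x \<in> carrier G" "ord x dvd p ^ k"
      using x by (auto simp: primary_elements_def)
    have "coprime (ord x) m"
      using coprime_divisors[OF k(2) dvd_refl] prime_imp_coprime[OF p m(2)] by simp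
    then show ?thesis
      using ord[OF k(1)] by (simp add: coprime_dvd_mult_left_iff)
  qed
  have reg: "ord x dvd m" if "x \<in> regular_elements p G" for x
  proof -
    have k: "x \<in> carrier G" "\<not> p dvd ord x"
      using that by (auto simp: regular_elements_def)
    have "coprime (ord x) q"
      unfolding q_def using k(2) p by (metis coprime_commute coprime_power_right_iff prime_imp_coprime)
    then show ?thesis
      using ord[OF k(1)] by (simp add: coprime_dvd_mult_right_iff)
  qed
  show ?thesis
  proof (rule that[of u v])
    fix x assume x: "x \<in> carrier G"
    show "x [^] u \<otimes> x [^] v = x"
      using pow_cong[OF x uv ord[OF x]] x by (simp add: nat_pow_mult)
    have "m dvd u" using u(2) by (simp add: cong_0_iff)
    then have "(x [^] u) [^] q = \<one>"
      using ord[OF x] x by (simp add: nat_pow_pow pow_eq_id)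
        (metis dvd_trans mult.commute mult_dvd_mono dvd_refl)
    then have "ord (x [^] u) dvd q" using x by (simp add: pow_eq_id)
    then show "x [^] u \<in> primary_elements p G"
      using x by (auto simp: primary_elements_def q_def)
    have "q dvd v" using v(1) by (simp add: cong_0_iff)
    then have "(x [^] v) [^] m = \<one>"
      using ord[OF x] x by (simp add: nat_pow_pow pow_eq_id)
        (metis dvd_trans mult_dvd_mono dvd_refl)
    then have "ord (x [^] v) dvd m" using x by (simp add: pow_eq_id)
    then show "x [^] v \<in> regular_elements p G"
      using x m(2) by (auto simp: regular_elements_def dest: dvd_trans)
  next
    fix x assume "x \<in> primary_elements p G"
    then show "x [^] u = x \<and> x [^] v = \<one>"
      using pow_cong[OF _ u(1), of x] pow_cong[OF _ v(1), of x] prim[of x]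
      by (simp add: primary_elements_def)
  next
    fix x assume "x \<in> regular_elements p G"
    then show "x [^] u = \<one> \<and> x [^] v = x"
      using pow_cong[OF _ u(2), of x] pow_cong[OF _ v(2), of x] reg[of x]
      by (simp add: regular_elements_def)
  qed
qed

text \<open>Each element is in exactly one way a product of a p-element x and a commuting element y
  of order prime to p. So the elements with p-part x correspond to the regular elements of the
  centralizer of x, and f is constant on them.\<close>

lemma (in group) sum_over_primary_parts:
  fixes f :: "'a \<Rightarrow> nat"
  assumes fin: "finite (carrier G)" and p: "Factorial_Ring.prime (p::nat)"
    and f: "\<And>x y. x \<in> primary_elements p G \<Longrightarrow> y \<in> regular_elements p G \<Longrightarrow> x \<otimes> y = y \<otimes> x \<Longrightarrow> f (x \<otimes> y) = f x"
  shows "sum f (carrier G) =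
    (\<Sum>x\<in>primary_elements p G. f x * card (centralizer G x \<inter> regular_elements p G))"
proof -
  obtain u v :: nat where uv:
    "\<And>x. x \<in> carrier G \<Longrightarrow> x [^] u \<otimes> x [^] v = x"
    "\<And>x. x \<in> carrier G \<Longrightarrow> x [^] u \<in> primary_elements p G"
    "\<And>x. x \<in> carrier G \<Longrightarrow> x [^] v \<in> regular_elements p G"
    "\<And>x. x \<in> primary_elements p G \<Longrightarrow> x [^] u = x \<and> x [^] v = \<one>"
    "\<And>x. x \<in> regular_elements p G \<Longrightarrow> x [^] u = \<one> \<and> x [^] v = x"
    using primary_decomposition[OF fin p] by blast
  have P: "primary_elements p G \<subseteq> carrier G" and R: "regular_elements p G \<subseteq> carrier G"
    by (auto simp: primary_elements_def regular_elements_def)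
  define S where "S = (SIGMA x:primary_elements p G. centralizer G x \<inter> regular_elements p G)"
  have S: "x \<in> carrier G" "y \<in> carrier G" "x \<otimes> y = y \<otimes> x" "(x \<otimes> y) [^] u = x" "(x \<otimes> y) [^] v = y"
    "x \<in> primary_elements p G" "y \<in> regular_elements p G"
    if "(x, y) \<in> S" for x y
  proof -
    show *: "x \<in> primary_elements p G" "y \<in> regular_elements p G" "x \<otimes> y = y \<otimes> x"
      using that by (auto simp: S_def centralizer_def)
    show xy: "x \<in> carrier G" "y \<in> carrier G"
      using * P R by auto
    show "(x \<otimes> y) [^] u = x" "(x \<otimes> y) [^] v = y"
      using uv(4)[OF *(1)] uv(5)[OF *(2)] xy
      by (simp_all add: pow_mult_distrib[OF *(3) xy])
  qed
  have "sum f (carrier G) = (\<Sum>(x, y)\<in>S. f x)"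
  proof (rule sum.reindex_bij_witness[where j = "\<lambda>g. (g [^] u, g [^] v)" and i = "\<lambda>(x, y). x \<otimes> y"])
    fix g assume g: "g \<in> carrier G"
    have c: "g [^] u \<otimes> g [^] v = g [^] v \<otimes> g [^] u"
      using g by (simp add: nat_pow_mult add.commute)
    show "(case (g [^] u, g [^] v) of (x, y) \<Rightarrow> x \<otimes> y) = g" using g uv(1) by simp
    show "(g [^] u, g [^] v) \<in> S"
      using g uv(2,3) c by (auto simp: S_def centralizer_def)
    show "(case (g [^] u, g [^] v) of (x, y) \<Rightarrow> f x) = f g"
      using f[OF uv(2)[OF g] uv(3)[OF g] c] uv(1) g by simp
  next
    fix z assume "z \<in> S"
    then show "((case z of (x, y) \<Rightarrow> x \<otimes> y) [^] u, (case z of (x, y) \<Rightarrow> x \<otimes> y) [^] v) = z"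
      and "(case z of (x, y) \<Rightarrow> x \<otimes> y) \<in> carrier G"
      using S by (auto split: prod.splits)
  qed
  also have "\<dots> = (\<Sum>x\<in>primary_elements p G. \<Sum>y\<in>centralizer G x \<inter> regular_elements p G. f x)"
    unfolding S_def using finite_subset[OF P fin] finite_subset[OF R fin]
    by (subst sum.Sigma) auto
  finally show ?thesis by (simp add: mult.commute)
qed

section \<open>Conjugacy classes of p-elements and Frobenius' theorem\<close>

lemma (in group) primary_elements_conj:
  assumes "g \<in> carrier G" "x \<in> carrier G"
  shows "g \<otimes> x \<otimes> inv g \<in> primary_elements p G \<longleftrightarrow> x \<in> primary_elements p G"
  using assms by (simp add: primary_elements_def ord_conj)

lemma (in group) conj_mult:
  assumes "g \<in> carrier G" "x \<in> carrier G" "y \<in> carrier G"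
  shows "(g \<otimes> x \<otimes> inv g) \<otimes> (g \<otimes> y \<otimes> inv g) = g \<otimes> (x \<otimes> y) \<otimes> inv g"
  using assms by (simp add: m_assoc) (simp flip: m_assoc)

lemma (in group) conj_eq_iff:
  assumes "g \<in> carrier G" "x \<in> carrier G" "y \<in> carrier G"
  shows "g \<otimes> x \<otimes> inv g = g \<otimes> y \<otimes> inv g \<longleftrightarrow> x = y"
  using assms by simp

lemma (in group) inv_conj_conj:
  assumes "g \<in> carrier G" "x \<in> carrier G"
  shows "g \<otimes> (inv g \<otimes> x \<otimes> g) \<otimes> inv g = x"
  using assms by (simp add: m_assoc) (simp flip: m_assoc)

lemma (in group) centralizer_conj:
  assumes "g \<in> carrier G" "x \<in> carrier G"
  shows "centralizer G (g \<otimes> x \<otimes> inv g) = (\<lambda>y. g \<otimes> y \<otimes> inv g) ` centralizer G x"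
proof (intro Set.set_eqI iffI)
  fix y assume y: "y \<in> centralizer G (g \<otimes> x \<otimes> inv g)"
  define z where "z = inv g \<otimes> y \<otimes> g"
  have z: "z \<in> carrier G" "y = g \<otimes> z \<otimes> inv g"
    using y assms by (auto simp: z_def centralizer_def inv_conj_conj)
  have "g \<otimes> (z \<otimes> x) \<otimes> inv g = g \<otimes> (x \<otimes> z) \<otimes> inv g"
    using y assms z(1) by (simp add: centralizer_def z(2) conj_mult)
  then have "z \<in> centralizer G x"
    using assms z(1) conj_eq_iff[of g "z \<otimes> x" "x \<otimes> z"] by (simp add: centralizer_def)
  then show "y \<in> (\<lambda>y. g \<otimes> y \<otimes> inv g) ` centralizer G x" using z(2) by blast
qed (use assms in \<open>auto simp: centralizer_def conj_mult\<close>)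

lemma (in group) card_centralizer_regular_conj:
  assumes "g \<in> carrier G" "x \<in> carrier G"
  shows "card (centralizer G (g \<otimes> x \<otimes> inv g) \<inter> regular_elements p G) =
    card (centralizer G x \<inter> regular_elements p G)"
proof -
  have "centralizer G (g \<otimes> x \<otimes> inv g) \<inter> regular_elements p G =
    (\<lambda>y. g \<otimes> y \<otimes> inv g) ` (centralizer G x \<inter> regular_elements p G)"
    unfolding centralizer_conj[OF assms]
    using assms(1) by (auto simp: regular_elements_def ord_conj centralizer_def)
  moreover have "inj_on (\<lambda>y. g \<otimes> y \<otimes> inv g) (centralizer G x \<inter> regular_elements p G)"
    using assms(1) by (auto simp: inj_on_def centralizer_def)
  ultimately show ?thesis by (simp add: card_image)
qed

text \<open>The summand, extended by 0 to all of G, is a class function, and the hypothesis on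
  centralizers is the condition of \<open>order_dvd_sum_class_function\<close>. Elements with w x =
  0 are exempt from it, so a weight can mask those about which nothing is known yet.\<close>

lemma (in group) order_dvd_primary_sum:
  fixes w :: "'a \<Rightarrow> nat"
  assumes fin: "finite (carrier G)"
    and inv: "\<And>g x. g \<in> carrier G \<Longrightarrow> x \<in> carrier G \<Longrightarrow> w (g \<otimes> x \<otimes> inv g) = w x"
    and dvd: "\<And>x. x \<in> primary_elements p G \<Longrightarrow> w x \<noteq> 0 \<Longrightarrow>
      \<exists>k. card (centralizer G x) dvd p ^ k * card (centralizer G x \<inter> regular_elements p G)"
  shows "\<exists>k. Coset.order G dvd
    p ^ k * (\<Sum>x\<in>primary_elements p G. w x * card (centralizer G x \<inter> regular_elements p G))"
proof -
  define r where "r x = card (centralizer G x \<inter> regular_elements p G)" for x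
  define w' where "w' x = (if x \<in> primary_elements p G then w x * r x else 0)" for x
  have P: "primary_elements p G \<subseteq> carrier G"
    by (auto simp: primary_elements_def)
  have "\<exists>k. card (centralizer G x) dvd p ^ k * w' x" if "x \<in> carrier G" for x
  proof (cases "x \<in> primary_elements p G \<and> w x \<noteq> 0")
    case True
    then show ?thesis using dvd[of x]
      by (auto simp: w'_def r_def mult.left_commute intro: dvd_mult)
  qed (auto simp: w'_def)
  then obtain k where k: "\<And>x. x \<in> carrier G \<Longrightarrow> card (centralizer G x) dvd p ^ k x * w' x"
    by metis
  \<comment> \<open>The exponents \<open>k x\<close> vary with x; their sum over G is a common
    bound.\<close>
  have "card (centralizer G x) dvd p ^ sum k (carrier G) * w' x" if x: "x \<in> carrier G" for x
  proof -
    have "p ^ k x dvd p ^ sum k (carrier G)"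
      using member_le_sum[OF x _ fin, of k] by (simp add: le_imp_power_dvd)
    then show ?thesis using k[OF x] by (meson dvd_refl dvd_trans mult_dvd_mono)
  qed
  then have "Coset.order G dvd p ^ sum k (carrier G) * sum w' (carrier G)"
    by (intro order_dvd_sum_class_function fin)
      (simp_all add: w'_def r_def inv primary_elements_conj card_centralizer_regular_conj)
  moreover have "sum w' (carrier G) = (\<Sum>x\<in>primary_elements p G. w x * r x)"
    unfolding w'_def using P fin by (simp add: sum.If_cases Int_absorb1)
  ultimately show ?thesis unfolding r_def by metis
qed

text \<open>
  A central primary element contributes the number of regular elements itself to the sum over
  primary parts; the classes of the other primary elements are handled by the hypothesis for
  their centralizers.
\<close>
lemma (in group) frobenius_regular_elements_step:
  assumes fin: "finite (carrier G)" and p: "Factorial_Ring.prime (p::nat)"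
    and IH: "\<And>H. subgroup H G \<Longrightarrow> card H < Coset.order G \<Longrightarrow>
      \<exists>k. card H dvd p ^ k * card (H \<inter> regular_elements p G)"
  shows "\<exists>k. Coset.order G dvd p ^ k * card (regular_elements p G)"
proof -
  define P where "P = primary_elements p G"
  define Z where "Z = {x \<in> P. centralizer G x = carrier G}"
  define r where "r x = card (centralizer G x \<inter> regular_elements p G)" for x
  \<comment> \<open>Weight 0 masks the central elements: their centralizer is all of G, out of reach
    of the induction hypothesis.\<close>
  define w where "w x = (if centralizer G x = carrier G then 0 else 1 :: nat)" for x
  have P: "P \<subseteq> carrier G" by (auto simp: P_def primary_elements_def)
  have finP: "finite P" using P fin by (rule finite_subset)
  have R: "regular_elements p G \<subseteq> carrier G" by (auto simp: regular_elements_def)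
  \<comment> \<open>Conjugate elements have centralizers of equal size, and whether a centralizer is
    all of G can be read off from its size.\<close>
  have w_conj: "w (g \<otimes> x \<otimes> inv g) = w x" if gx: "g \<in> carrier G" "x \<in> carrier G" for g x
  proof -
    have C: "centralizer G y \<subseteq> carrier G" for y
      by (auto simp: centralizer_def)
    have "card (centralizer G (g \<otimes> x \<otimes> inv g)) = card (centralizer G x)"
      unfolding centralizer_conj[OF gx] using gx(1) C by (intro card_image) (auto simp: inj_on_def subset_iff)
    then show ?thesis unfolding w_def using C fin by (metis card_subset_eq)
  qed
  have "\<exists>k. card (centralizer G x) dvd p ^ k * r x" if x: "x \<in> P" "w x \<noteq> 0" for x
  proof -
    have sg: "subgroup (centralizer G x) G"
      using x P by (intro centralizer_subgroup) auto
    have "centralizer G x \<subset> carrier G"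
      using x(2) subgroup.subset[OF sg] by (auto simp: w_def split: if_splits)
    then have "card (centralizer G x) < card (carrier G)"
      by (rule psubset_card_mono[OF fin])
    then show ?thesis
      using IH[OF sg] by (simp add: r_def Coset.order_def)
  qed
  then obtain k where k: "Coset.order G dvd p ^ k * (\<Sum>x\<in>P. w x * r x)"
    using order_dvd_primary_sum[OF fin w_conj, of p] unfolding P_def r_def by blast
  have "Coset.order G = (\<Sum>x\<in>P. r x)"
    using sum_over_primary_parts[OF fin p, of "\<lambda>_. 1"] unfolding P_def r_def by (simp add: Coset.order_def)
  also have "\<dots> = (\<Sum>x\<in>Z. r x) + (\<Sum>x\<in>P - Z. r x)"
    using sum.subset_diff[of Z P r] finP by (simp add: Z_def)
  also have "(\<Sum>x\<in>Z. r x) = card Z * card (regular_elements p G)"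
    using R by (simp add: Z_def r_def Int_absorb1)
  also have "(\<Sum>x\<in>P - Z. r x) = (\<Sum>x\<in>P. w x * r x)"
    using finP by (intro sum.mono_neutral_cong_left) (auto simp: Z_def w_def)
  finally have eq: "Coset.order G = card Z * card (regular_elements p G) + (\<Sum>x\<in>P. w x * r x)" .
  \<comment> \<open>Up to a power of p, the order divides both the total and the noncentral part,
    hence also the central part.\<close>
  have "Coset.order G dvd p ^ k * (card Z * card (regular_elements p G))"
  proof -
    have "Coset.order G dvd p ^ k * Coset.order G" by simp
    then have "Coset.order G dvd p ^ k * (card Z * card (regular_elements p G)) + p ^ k * (\<Sum>x\<in>P. w x * r x)"
      by (subst (asm) (2) eq) (simp only: distrib_left)
    then show ?thesis using k by (metis dvd_add_left_iff)
  qed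
  \<comment> \<open>The central p-elements form a p-group, so the factor \<open>card Z\<close> is
    absorbed into the power of p.\<close>
  moreover have "\<exists>j. card Z = p ^ j"
  proof -
    have comm: "x \<otimes> y = y \<otimes> x" if "x \<in> Z" "y \<in> carrier G" for x y
    proof -
      have "y \<in> centralizer G x" using that by (simp add: Z_def)
      then show ?thesis by (simp add: centralizer_def)
    qed
    have ZG: "Z \<subseteq> carrier G" using P by (auto simp: Z_def)
    have cI: "centralizer G x = carrier G" if "\<And>y. y \<in> carrier G \<Longrightarrow> x \<otimes> y = y \<otimes> x" for x
      using that by (auto simp: centralizer_def)
    have sg: "subgroup Z G"
    proof
      show "Z \<subseteq> carrier G" by (rule ZG)
      show "\<one> \<in> Z"
        using cI[of \<one>] by (simp add: Z_def P_def primary_elements_def)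
    next
      fix x y assume xy: "x \<in> Z" "y \<in> Z"
      then have c: "x \<in> carrier G" "y \<in> carrier G" using ZG by auto
      obtain i j where "ord x dvd p ^ i" "ord y dvd p ^ j"
        using xy by (auto simp: Z_def P_def primary_elements_def)
      then have "ord (x \<otimes> y) dvd p ^ (i + j)"
        using ord_mul_divides[OF comm[OF xy(1) c(2)] c]
        by (metis dvd_trans mult_dvd_mono power_add)
      moreover have "centralizer G (x \<otimes> y) = carrier G"
        using comm[OF xy(1)] comm[OF xy(2)] c by (intro cI) (metis m_assoc)
      ultimately show "x \<otimes> y \<in> Z"
        using c by (auto simp: Z_def P_def primary_elements_def)
    next
      fix x assume x: "x \<in> Z"
      then have c: "x \<in> carrier G" using ZG by auto
      have "centralizer G (inv x) = carrier G"
        using comm[OF x] c by (intro cI) (metis inv_closed inv_inv inv_mult_group)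
      then show "inv x \<in> Z"
        using x c by (auto simp: Z_def P_def primary_elements_def)
    qed
    interpret Z: group "G\<lparr>carrier := Z\<rparr>" by (rule subgroup_imp_group[OF sg])
    have "Z \<subseteq> P" by (auto simp: Z_def)
    then have "carrier (G\<lparr>carrier := Z\<rparr>) \<subseteq> primary_elements p (G\<lparr>carrier := Z\<rparr>)"
      by (auto simp: P_def primary_elements_def ord_subgroup[OF sg])
    then show ?thesis
      using Z.order_eq_prime_power[OF _ p] finite_subset[OF ZG fin] by (auto simp: Coset.order_def)
  qed
  ultimately show ?thesis
    by (metis mult.assoc power_add)
qed

text \<open>Frobenius' theorem: the p'-part of |H| divides the number of elements of H of order
  prime to p. A subgroup of H is again a subgroup of the fixed G, so strong induction on
  \<open>card H\<close> supplies the hypothesis of the step lemma.\<close>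

theorem (in group) frobenius_regular_elements:
  assumes fin: "finite (carrier G)" and p: "Factorial_Ring.prime (p::nat)" and "subgroup H G"
  shows "\<exists>k. card H dvd p ^ k * card (H \<inter> regular_elements p G)"
  using assms(3)
proof (induction "card H" arbitrary: H rule: less_induct)
  case less
  note sg = less.prems
  interpret H: group "G\<lparr>carrier := H\<rparr>" by (rule subgroup_imp_group[OF sg])
  have "\<exists>k. Coset.order (G\<lparr>carrier := H\<rparr>) dvd p ^ k * card (regular_elements p (G\<lparr>carrier := H\<rparr>))"
  proof (rule H.frobenius_regular_elements_step[OF _ p])
    show "finite (carrier (G\<lparr>carrier := H\<rparr>))"
      using finite_subset[OF subgroup.subset[OF sg] fin] by simp
    fix K assume K: "subgroup K (G\<lparr>carrier := H\<rparr>)" "card K < Coset.order (G\<lparr>carrier := H\<rparr>)"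
    have "K \<subseteq> H" using subgroup.subset[OF K(1)] by simp
    then show "\<exists>k. card K dvd p ^ k * card (K \<inter> regular_elements p (G\<lparr>carrier := H\<rparr>))"
      using less.hyps[of K] K incl_subgroup[OF sg K(1)]
      by (simp add: Coset.order_def regular_elements_subgroup[OF sg] Int_absorb2 flip: Int_assoc)
  qed
  then show ?case by (simp add: Coset.order_def regular_elements_subgroup[OF sg])
qed

section \<open>Exponents of the product of element orders\<close>

text \<open>For a prime p dividing the order of a finite G this is the exponent of p in
  \<open>prod_ord G\<close>, written as a sum of a class function so that the counting above
  applies.\<close>

definition exponent_sum :: "nat \<Rightarrow> ('a, 'b) monoid_scheme \<Rightarrow> nat" where
  "exponent_sum p G = (\<Sum>g\<in>carrier G. multiplicity p (group.ord G g))"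

text \<open>The p-adic valuation of the order depends only on the p-part of the element, so it can
  serve as the weight in the sum over p-parts; Frobenius' theorem for the centralizers does the
  rest.\<close>

lemma (in group) order_dvd_exponent_sum:
  assumes fin: "finite (carrier G)" and p: "Factorial_Ring.prime (p::nat)"
  shows "\<exists>k. Coset.order G dvd p ^ k * exponent_sum p G"
proof -
  have f: "multiplicity p (ord (x \<otimes> y)) = multiplicity p (ord x)"
    if x: "x \<in> primary_elements p G" and y: "y \<in> regular_elements p G" and c: "x \<otimes> y = y \<otimes> x" for x y
  proof -
    have xy: "x \<in> carrier G" "y \<in> carrier G" "\<not> p dvd ord y"
      using x y by (auto simp: primary_elements_def regular_elements_def)
    have pos: "ord z \<noteq> 0" if "z \<in> carrier G" for z
      using ord_ge_1[OF fin that] by simp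
    obtain k where k: "ord x dvd p ^ k"
      using x by (auto simp: primary_elements_def)
    have "multiplicity p (ord x * ord y) = multiplicity p (ord x) + multiplicity p (ord y)"
      using pos xy p by (simp add: prime_elem_multiplicity_mult_distrib)
    then have le: "multiplicity p (ord (x \<otimes> y)) \<le> multiplicity p (ord x)"
      using dvd_imp_multiplicity_le[OF ord_mul_divides[OF c xy(1,2)], of p] pos xy
      by (simp add: not_dvd_imp_multiplicity_0)
    \<comment> \<open>For the other inequality: the exponent
      \<open>ord (x \<otimes> y) * ord y\<close> kills the product and y, hence x. As the orders of
      x and y are coprime, \<open>ord x\<close> divides \<open>ord (x \<otimes> y)\<close>.\<close>
    have "(x \<otimes> y) [^] (ord (x \<otimes> y) * ord y) = \<one>"
      using xy by (simp flip: nat_pow_pow)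
    then have "x [^] (ord (x \<otimes> y) * ord y) \<otimes> y [^] (ord (x \<otimes> y) * ord y) = \<one>"
      using pow_mult_distrib[OF c xy(1,2)] by simp
    moreover have "y [^] (ord (x \<otimes> y) * ord y) = \<one>"
      using xy by (simp add: pow_eq_id)
    ultimately have "ord x dvd ord (x \<otimes> y) * ord y"
      using xy by (simp add: pow_eq_id)
    moreover have "coprime (ord x) (ord y)"
      using coprime_divisors[OF k dvd_refl] prime_imp_coprime[OF p xy(3)] by simp
    ultimately have "ord x dvd ord (x \<otimes> y)"
      by (simp add: coprime_dvd_mult_left_iff)
    then have "multiplicity p (ord x) \<le> multiplicity p (ord (x \<otimes> y))"
      using pos xy by (intro dvd_imp_multiplicity_le) auto
    with le show ?thesis by simp
  qed
  have "\<exists>k. card (centralizer G x) dvd p ^ k * card (centralizer G x \<inter> regular_elements p G)"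
    if x: "x \<in> primary_elements p G" for x
  proof -
    have sg: "subgroup (centralizer G x) G"
      using x by (intro centralizer_subgroup) (auto simp: primary_elements_def)
    show ?thesis
      by (rule frobenius_regular_elements[OF fin p sg])
  qed
  then have "\<exists>k. Coset.order G dvd p ^ k *
    (\<Sum>x\<in>primary_elements p G. multiplicity p (ord x) * card (centralizer G x \<inter> regular_elements p G))"
    by (intro order_dvd_primary_sum[OF fin]) (simp_all add: ord_conj)
  then show ?thesis
    unfolding exponent_sum_def using sum_over_primary_parts[OF fin p f] by simp
qed

lemma (in group) dvd_exponent_sum:
  assumes fin: "finite (carrier G)" and p: "Factorial_Ring.prime (p::nat)"
    and m: "m dvd Coset.order G" "\<not> p dvd m"
  shows "m dvd exponent_sum p G"
proof -
  obtain k where "Coset.order G dvd p ^ k * exponent_sum p G"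
    using order_dvd_exponent_sum[OF fin p] by blast
  then have "m dvd p ^ k * exponent_sum p G" using m(1) by (rule dvd_trans[rotated])
  moreover have "coprime m (p ^ k)"
    using prime_imp_coprime[OF p m(2)] by (simp add: coprime_commute)
  ultimately show ?thesis by (simp add: coprime_dvd_mult_right_iff)
qed

lemma iso_ord:
  assumes "group G" "group H" "f \<in> iso G H" "x \<in> carrier G"
  shows "group.ord H (f x) = group.ord G x"
proof -
  interpret G: group G by fact
  interpret H: group H by fact
  have hom: "f \<in> hom G H" and bij: "bij_betw f (carrier G) (carrier H)"
    using assms(3) by (auto simp: iso_def)
  interpret f: group_hom G H f
    using hom by unfold_locales
  have "f (y) = \<one>\<^bsub>H\<^esub> \<longleftrightarrow> y = \<one>\<^bsub>G\<^esub>" if "y \<in> carrier G" for y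
    using bij that f.hom_one G.one_closed by (metis bij_betw_inv_into_left)
  then show ?thesis
    unfolding G.ord_def H.ord_def using assms(4) by (simp flip: f.hom_nat_pow)
qed

lemma Exp_rho_iso:
  assumes "group G" "group H" "G \<cong> H"
  shows "Exp_rho G = Exp_rho H"
proof -
  obtain f where f: "f \<in> iso G H" using assms(3) by (auto simp: is_iso_def)
  then have "bij_betw f (carrier G) (carrier H)" by (auto simp: iso_def)
  then have "prod_ord H = prod_ord G"
    unfolding prod_ord_def
    by (subst prod.reindex_bij_betw[symmetric]) (auto intro: prod.cong iso_ord[OF assms(1,2) f])
  then show ?thesis by (simp add: Exp_rho_def)
qed

lemma (in group) order_ne_0:
  "finite (carrier G) \<Longrightarrow> Coset.order G \<noteq> 0"
  using one_closed by (auto simp: Coset.order_def)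

text \<open>The primes dividing the product of the orders are those dividing |G|: Lagrange gives one
  inclusion, Cauchy the other.\<close>

lemma (in group) Exp_rho_eq:
  assumes fin: "finite (carrier G)"
  shows "Exp_rho G = (\<lambda>p. exponent_sum p G) ` prime_factors (Coset.order G)"
proof -
  have nz: "ord g \<noteq> 0" if "g \<in> carrier G" for g
    using ord_ge_1[OF fin that] by simp
  have "prime_factors (prod_ord G) = prime_factors (Coset.order G)"
  proof (intro Set.set_eqI iffI)
    fix p assume "p \<in> prime_factors (prod_ord G)"
    then have p: "Factorial_Ring.prime p" "p dvd prod_ord G" by auto
    then obtain g where "g \<in> carrier G" "p dvd ord g"
      using fin by (auto simp: prod_ord_def prime_dvd_prod_iff)
    then show "p \<in> prime_factors (Coset.order G)"
      using p(1) order_ne_0[OF fin] ord_dvd_group_order[of g]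
      by (meson dvd_trans in_prime_factors_iff)
  next
    fix p assume "p \<in> prime_factors (Coset.order G)"
    then have p: "Factorial_Ring.prime p" "p dvd Coset.order G" by auto
    then obtain g where g: "g \<in> carrier G" "ord g = p"
      using cauchy[OF fin] by blast
    have "ord g dvd prod_ord G"
      using g(1) fin unfolding prod_ord_def by (intro dvd_prodI)
    moreover have "prod_ord G \<noteq> 0"
      using fin nz by (simp add: prod_ord_def)
    ultimately show "p \<in> prime_factors (prod_ord G)"
      using p(1) g(2) by (auto simp: in_prime_factors_iff)
  qed
  moreover have "multiplicity p (prod_ord G) = exponent_sum p G"
    if "p \<in> prime_factors (Coset.order G)" for p
  proof -
    have "0 \<notin> ord ` carrier G" using nz by (metis imageE)
    then show ?thesis
      unfolding prod_ord_def exponent_sum_def using that fin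
      by (intro prime_elem_multiplicity_prod_distrib) auto
  qed
  ultimately show ?thesis
    unfolding Exp_rho_def Exp_def by (auto intro!: image_cong)
qed

lemma (in group) exponent_sum_pos:
  assumes fin: "finite (carrier G)" and p: "Factorial_Ring.prime (p::nat)" "p dvd Coset.order G"
  shows "exponent_sum p G > 0"
proof -
  obtain g where g: "g \<in> carrier G" "ord g = p"
    using cauchy[OF fin p] by blast
  have "multiplicity p (ord g) \<le> exponent_sum p G"
    unfolding exponent_sum_def using g(1) fin by (intro member_le_sum) auto
  moreover have "multiplicity p (ord g) > 0"
    using g p by (simp add: prime_multiplicity_gt_zero_iff prime_gt_0_nat)
  ultimately show ?thesis by linarith
qed

lemma (in group) Exp_rho_15_20_24:
  assumes fin: "finite (carrier G)" and E: "Exp_rho G = {15, 20, 24}"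
  shows "Coset.order G \<in> {30, 60}"
    and "exponent_sum 2 G = 15" and "exponent_sum 3 G = 20" and "exponent_sum 5 G = 24"
proof -
  define e where "e p = exponent_sum p G" for p
  define n where "n = Coset.order G"
  have E': "e ` prime_factors n = {15, 20, 24}"
    using E unfolding Exp_rho_eq[OF fin] e_def n_def .
  obtain p q r where pqr: "p \<in> prime_factors n" "q \<in> prime_factors n" "r \<in> prime_factors n"
    "e p = 15" "e q = 20" "e r = 24"
  proof -
    have *: "15 \<in> e ` prime_factors n" "20 \<in> e ` prime_factors n" "24 \<in> e ` prime_factors n"
      unfolding E' by auto
    show ?thesis
      by (rule imageE[OF *(1)], rule imageE[OF *(2)], rule imageE[OF *(3)]) (rule that, auto)
  qed
  have pr: "Factorial_Ring.prime p" "Factorial_Ring.prime q" "Factorial_Ring.prime r"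
    using pqr by auto
  have ne: "p \<noteq> q" "p \<noteq> r" "q \<noteq> r" using pqr by auto
  have dvd: "m dvd e s" if "s \<in> prime_factors n" "m dvd n" "\<not> s dvd m" for s m
    using dvd_exponent_sum[OF fin, of s m] that by (auto simp: e_def n_def)
  have prime_dvd: "s dvd e t" if "s \<in> prime_factors n" "t \<in> prime_factors n" "s \<noteq> t" for s t
    using that primes_dvd_imp_eq[of t s] by (intro dvd) auto
  have "q dvd 15" "r dvd 15" "p dvd 20" "r dvd 20" "p dvd 24" "q dvd 24"
    using prime_dvd pqr ne by metis+
  then have "q dvd gcd 15 24" "r dvd gcd 15 20" "p dvd gcd 20 24" by (meson gcd_greatest)+
  moreover have "gcd 15 24 = (3::nat)" "gcd 15 20 = (5::nat)" "gcd 20 24 = (2 ^ 2 :: nat)" by code_simp+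
  ultimately have "q dvd 3" "r dvd 5" "p dvd 2 ^ 2" by metis+
  then have "q dvd 3" "r dvd 5" "p dvd 2" using pr prime_dvd_power by metis+
  then have *: "p = 2" "q = 3" "r = 5"
    using pr by (auto intro!: primes_dvd_imp_eq)
  show "exponent_sum 2 G = 15" "exponent_sum 3 G = 20" "exponent_sum 5 G = 24"
    using pqr * by (auto simp: e_def)
  have n0: "n \<noteq> 0" using order_ne_0[OF fin] by (simp add: n_def)
  obtain m where m: "n = 2 ^ multiplicity 2 n * m" "\<not> 2 dvd m"
    using multiplicity_decompose'[of n 2] n0 by auto
  define a where "a = multiplicity 2 n"
  \<comment> \<open>The odd part m of the order divides e(2) = 15 and is itself divisible by 3 and
    5.\<close>
  have "m dvd 15" using dvd[of 2 m] m pqr * by (metis dvd_triv_right)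
  moreover have "3 dvd m" "5 dvd m"
  proof -
    have "3 dvd 2 ^ a * m" "5 dvd 2 ^ a * m"
      using pqr * m(1) by (auto simp: a_def)
    moreover have "coprime 3 (2 ^ a :: nat)" "coprime 5 (2 ^ a :: nat)" by auto
    ultimately show "3 dvd m" "5 dvd m" by (simp_all add: coprime_dvd_mult_right_iff)
  qed
  moreover from this have "15 dvd m" by presburger
  ultimately have m15: "m = 15" by (intro dvd_antisym)
  have "n = 2 ^ a * 15" using m(1) m15 by (simp add: a_def)
  \<comment> \<open>The divisor 2^a * 5 of the order is prime to 3, so it divides e(3) = 20, whence
    a \<le> 2.\<close>
  have "\<not> 3 dvd 2 ^ a * (5::nat)"
    using prime_dvd_power[of "3 :: nat" 2 a] by (auto simp: prime_dvd_mult_iff)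
  moreover have "2 ^ a * 5 dvd n" unfolding \<open>n = 2 ^ a * 15\<close> by simp
  ultimately have "2 ^ a * 5 dvd (20::nat)"
    using dvd[of 3 "2 ^ a * 5"] pqr * by simp
  then have "5 * 2 ^ a dvd (5 * 2 ^ 2::nat)" by (simp add: mult.commute)
  then have "2 ^ a dvd (2 ^ 2::nat)" by (rule dvd_mult_cancel) simp
  then have "a \<le> 2" using power_dvd_imp_le[of 2 a 2] by simp
  moreover have "a \<noteq> 0" using pqr(1) * n0 in_prime_factors_imp_dvd[of 2 n]
    by (simp add: a_def multiplicity_eq_zero_iff)
  ultimately have "a = 1 \<or> a = 2" by linarith
  then show "Coset.order G \<in> {30, 60}"
    using \<open>n = 2 ^ a * 15\<close> by (auto simp: n_def)
qed

text \<open>No element order is divisible by p^2, so each valuation is 0 or 1.\<close>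

lemma (in group) exponent_sum_eq_card:
  assumes fin: "finite (carrier G)" and p: "Factorial_Ring.prime (p::nat)"
    and sq: "\<not> p\<^sup>2 dvd Coset.order G"
  shows "exponent_sum p G = card {g \<in> carrier G. p dvd ord g}"
proof -
  have "multiplicity p (ord g) = (if p dvd ord g then 1 else 0)" if g: "g \<in> carrier G" for g
  proof -
    have "\<not> p\<^sup>2 dvd ord g"
      using sq ord_dvd_group_order[OF g] by (meson dvd_trans)
    then show ?thesis
      using ord_ge_1[OF fin g] p
      by (auto intro: multiplicity_eqI simp: not_dvd_imp_multiplicity_0 power2_eq_square)
  qed
  then have "exponent_sum p G = (\<Sum>g\<in>carrier G. if p dvd ord g then 1 else 0)"
    by (simp add: exponent_sum_def)
  also have "\<dots> = card {g \<in> carrier G. p dvd ord g}"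
    using fin by (simp add: sum.If_cases Int_def)
  finally show ?thesis .
qed

section \<open>Groups of order 30\<close>

lemma (in group) iso_integer_mod_group:
  assumes fin: "finite (carrier G)" and x: "x \<in> carrier G" "ord x = Coset.order G"
  shows "G \<cong> integer_mod_group (Coset.order G)"
proof -
  let ?Z = "integer_mod_group (Coset.order G)"
  define f where "f i = x [^] i" for i :: int
  have n: "Coset.order G \<noteq> 0" using order_ne_0[OF fin] .
  have carr: "carrier ?Z = {0..<int (Coset.order G)}"
    using n by (simp add: carrier_integer_mod_group)
  have "inj_on f (carrier ?Z)"
  proof (rule inj_onI)
    fix i j assume ij: "i \<in> carrier ?Z" "j \<in> carrier ?Z" "f i = f j"
    then have "int (Coset.order G) dvd j - i"
      using int_pow_eq[OF x(1)] x(2) by (simp add: f_def)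
    then have "j mod int (Coset.order G) = i mod int (Coset.order G)" by (simp add: mod_eq_dvd_iff)
    then show "i = j" using ij by (simp add: carr)
  qed
  moreover have "f ` carrier ?Z \<subseteq> carrier G" using x by (auto simp: f_def)
  ultimately have "bij_betw f (carrier ?Z) (carrier G)"
    using fin by (intro bij_betw_imageI card_subset_eq) (auto simp: card_image carr, simp add: Coset.order_def)
  moreover have "f \<in> hom ?Z G"
  proof (rule homI)
    fix i j
    have "x [^] ((i + j) mod int (Coset.order G)) = x [^] (i + j)"
      using int_pow_eq[OF x(1)] x(2) by (simp add: dvd_minus_mod)
    then show "f (i \<otimes>\<^bsub>?Z\<^esub> j) = f i \<otimes> f j"
      using x(1) by (simp add: f_def int_pow_mult)
  qed (use x in \<open>simp add: f_def\<close>)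
  ultimately have "f \<in> iso ?Z G" by (simp add: iso_def)
  then show ?thesis
    using group.iso_sym[OF group_integer_mod_group] by (auto simp: is_iso_def)
qed

lemma (in group) order_30_cyclic:
  assumes n: "Coset.order G = 30"
    and e: "exponent_sum 2 G = 15" "exponent_sum 3 G = 20" "exponent_sum 5 G = 24"
  shows "G \<cong> integer_mod_group 30"
proof -
  have fin: "finite (carrier G)"
    using n by (intro card_ge_0_finite) (simp add: Coset.order_def)
  \<comment> \<open>The identity would lie in all three sets. Without it they have 14 + 9 + 5 = 28
    elements at most, against 29 nonidentity elements, so some order is divisible by 2, 3 and
    5.\<close>
  define R where "R p = {g \<in> carrier G. \<not> p dvd ord g} - {\<one>}" for p
  have R: "card (R p) + exponent_sum p G = 29"
    if p: "Factorial_Ring.prime p" "\<not> p\<^sup>2 dvd 30" for p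
  proof -
    have eq: "carrier G - {\<one>} = R p \<union> {g \<in> carrier G. p dvd ord g}"
      using p(1) by (auto simp: R_def)
    have "card (carrier G - {\<one>}) = card (R p) + card {g \<in> carrier G. p dvd ord g}"
      unfolding eq using fin by (intro card_Un_disjoint) (auto simp: R_def)
    moreover have "card (carrier G - {\<one>}) = 29"
      using n by (simp add: Coset.order_def)
    ultimately show ?thesis
      using exponent_sum_eq_card[OF fin p(1)] p(2) n by simp
  qed
  have c: "card (R 2) = 14" "card (R 3) = 9" "card (R 5) = 5"
    using R[of 2] R[of 3] R[of 5] e by simp_all
  have "card (R 2 \<union> R 3 \<union> R 5) \<le> 28"
    using card_Un_le[of "R 2 \<union> R 3" "R 5"] card_Un_le[of "R 2" "R 3"] c by linarith
  moreover have "card (carrier G - {\<one>}) = 29"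
    using n by (simp add: Coset.order_def)
  moreover have "finite (R 2 \<union> R 3 \<union> R 5)" using fin by (auto simp: R_def)
  ultimately have "\<not> carrier G - {\<one>} \<subseteq> R 2 \<union> R 3 \<union> R 5"
    using card_mono[of "R 2 \<union> R 3 \<union> R 5" "carrier G - {\<one>}"] by auto
  then obtain g where g: "g \<in> carrier G" "2 dvd ord g" "3 dvd ord g" "5 dvd ord g"
    by (auto simp: R_def)
  have "30 dvd ord g"
    using g(2-4) by presburger
  then have "ord g = Coset.order G"
    using ord_dvd_group_order[OF g(1)] n by (simp add: dvd_antisym)
  then show ?thesis using iso_integer_mod_group[OF fin g(1)] n by simp
qed

lemma prime_factors_30: "prime_factors (30::nat) = {2, 3, 5}"
proof -
  have "prime_factors (2 * (3 * 5) :: nat) = {2, 3, 5}"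
    by (subst prime_factors_product, simp, simp)+ (auto simp: prime_prime_factors)
  then show ?thesis by simp
qed

text \<open>With 30 = p * m, the order of x divides m exactly if p divides the integer x. So p
  divides the orders of the other 30 - m elements, and m = 15, 10, 6 yields the exponents.\<close>

lemma Exp_rho_integer_mod_group_30: "Exp_rho (integer_mod_group 30) = {15, 20, 24}"
proof -
  let ?Z = "integer_mod_group 30"
  interpret Z: group ?Z by simp
  have carr: "carrier ?Z = {0..<30}" by (simp add: carrier_integer_mod_group)
  have fin: "finite (carrier ?Z)" by (simp add: carr)
  have ord: "Coset.order ?Z = 30" by (simp add: Coset.order_def carr)
  have dvd_iff: "p dvd Z.ord x \<longleftrightarrow> \<not> int p dvd x"
    if x: "x \<in> carrier ?Z" and p: "Factorial_Ring.prime p" "p * m = 30" "\<not> p dvd m" for x p m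
  proof -
    have "Z.ord x dvd m \<longleftrightarrow> int 30 dvd int m * x"
      unfolding Z.pow_eq_id[OF x, symmetric] by (simp add: dvd_eq_mod_eq_0)
    also have "\<dots> \<longleftrightarrow> int p dvd x"
    proof -
      have "m \<noteq> 0" using p(2) by (intro notI) simp
      moreover have "int 30 = int m * int p" unfolding p(2)[symmetric] by simp
      ultimately show ?thesis by (simp only: dvd_mult_cancel_left of_nat_eq_0_iff simp_thms)
    qed
    also have "Z.ord x dvd m \<longleftrightarrow> \<not> p dvd Z.ord x"
    proof
      assume "Z.ord x dvd m"
      then show "\<not> p dvd Z.ord x" using p(3) by (meson dvd_trans)
    next
      assume "\<not> p dvd Z.ord x"
      moreover have "Z.ord x dvd p * m" using Z.ord_dvd_group_order[OF x] ord p(2) by simp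
      ultimately show "Z.ord x dvd m"
        using prime_imp_coprime[OF p(1), of "Z.ord x"]
        by (simp add: coprime_commute coprime_dvd_mult_right_iff)
    qed
    finally show ?thesis by blast
  qed
  have e: "exponent_sum p ?Z = card {x \<in> {0..<30}. \<not> int p dvd x}"
    if p: "Factorial_Ring.prime p" "p * m = 30" "\<not> p dvd m" for p m
  proof -
    have "\<not> p\<^sup>2 dvd p * m"
      using dvd_mult_cancel[of p p m] p prime_gt_0_nat[OF p(1)] by (auto simp only: power2_eq_square)
    then have "\<not> p\<^sup>2 dvd Coset.order ?Z" by (simp only: ord p(2) simp_thms)
    then have "exponent_sum p ?Z = card {g \<in> carrier ?Z. p dvd Z.ord g}"
      by (rule Z.exponent_sum_eq_card[OF fin p(1)])
    also have "{g \<in> carrier ?Z. p dvd Z.ord g} = {x \<in> {0..<30}. \<not> int p dvd x}"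
      using dvd_iff[OF _ p] unfolding carr by blast
    finally show ?thesis .
  qed
  \<comment> \<open>As list lengths the three cardinalities can be evaluated.\<close>
  have "card {x \<in> {0..<30}. P x} = length (filter P [0..29])" for P :: "int \<Rightarrow> bool"
  proof -
    have "{x \<in> {0..<30}. P x} = set (filter P [0..29])" by auto
    then show ?thesis by (simp only: distinct_card distinct_filter distinct_upto)
  qed
  moreover have "length (filter (\<lambda>x. \<not> int 2 dvd x) [0..29]) = 15"
    "length (filter (\<lambda>x. \<not> int 3 dvd x) [0..29]) = 20"
    "length (filter (\<lambda>x. \<not> int 5 dvd x) [0..29]) = 24"
    by code_simp+
  ultimately have "card {x \<in> {0..<30}. \<not> int 2 dvd x} = 15" "card {x \<in> {0..<30}. \<not> int 3 dvd x} = 20"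
    "card {x \<in> {0..<30}. \<not> int 5 dvd x} = 24"
    by (simp_all only:)
  then have "exponent_sum 2 ?Z = 15" "exponent_sum 3 ?Z = 20" "exponent_sum 5 ?Z = 24"
    using e[of 2 15] e[of 3 10] e[of 5 6] by simp_all
  then show ?thesis
    by (simp add: Z.Exp_rho_eq[OF fin] ord prime_factors_30)
qed

section \<open>Groups of order 60 with elements of prime order\<close>

text \<open>The common ground of PSL(2,5) and the groups of order 60 with the given exponents;
  results proved here are used for both.\<close>

locale order_60_prime_ords = group G for G (structure) +
  assumes order_60: "Coset.order G = 60"
    and prime_ords: "g \<in> carrier G \<Longrightarrow> ord g \<in> {1, 2, 3, 5}"
begin

lemma fin: "finite (carrier G)"
  using order_60 by (intro card_ge_0_finite) (simp add: Coset.order_def)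

lemma prime_ord:
  assumes "g \<in> carrier G" "g \<noteq> \<one>"
  shows "Factorial_Ring.prime (ord g)"
  using prime_ords[OF assms(1)] ord_eq_1[OF assms(1)] assms(2) by auto

lemma exponent_sum_eq_card_ord:
  assumes p: "Factorial_Ring.prime p"
  shows "exponent_sum p G = card {g \<in> carrier G. ord g = p}"
proof -
  have "multiplicity p (ord g) = (if ord g = p then 1 else 0)" if g: "g \<in> carrier G" for g
  proof (cases "g = \<one>")
    case True
    then show ?thesis using p by auto
  next
    case False
    then show ?thesis
      using prime_ord[OF g] p prime_multiplicity_other[of p "ord g"] by auto
  qed
  then have "exponent_sum p G = (\<Sum>g\<in>carrier G. if ord g = p then 1 else 0)"
    by (simp add: exponent_sum_def)
  also have "\<dots> = card {g \<in> carrier G. ord g = p}"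
    using fin by (simp add: sum.If_cases Int_def)
  finally show ?thesis .
qed

text \<open>Each nonidentity element is counted by exactly one of the three sums, so they add up to
  59. They are positive multiples of 15, 20 and 12, and 15 + 20 + 2 * 12 is the only such
  decomposition of 59.\<close>

lemma exponent_sums:
  "exponent_sum 2 G = 15" "exponent_sum 3 G = 20" "exponent_sum 5 G = 24"
proof -
  define I where "I p = {g \<in> carrier G. ord g = p}" for p
  have e: "exponent_sum p G = card (I p)" if "Factorial_Ring.prime p" for p
    using exponent_sum_eq_card_ord[OF that] by (simp add: I_def)
  have finI: "finite (I p)" for p using fin by (simp add: I_def)
  have "carrier G - {\<one>} = I 2 \<union> I 3 \<union> I 5"
    using prime_ords ord_eq_1 by (auto simp: I_def)
  moreover have "card (I 2 \<union> I 3 \<union> I 5) = card (I 2) + card (I 3) + card (I 5)"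
  proof -
    have "(I 2 \<union> I 3) \<inter> I 5 = {}" "I 2 \<inter> I 3 = {}" by (auto simp: I_def)
    then show ?thesis by (simp only: card_Un_disjoint finI finite_UnI)
  qed
  moreover have "card (carrier G - {\<one>}) = 59"
    using order_60 by (simp add: Coset.order_def)
  ultimately have "exponent_sum 2 G + exponent_sum 3 G + exponent_sum 5 G = 59"
    by (simp add: e)
  moreover have "15 dvd exponent_sum 2 G" "20 dvd exponent_sum 3 G" "12 dvd exponent_sum 5 G"
    by (rule dvd_exponent_sum[OF fin]; simp add: order_60)+
  moreover have "exponent_sum 2 G > 0" "exponent_sum 3 G > 0" "exponent_sum 5 G > 0"
    by (rule exponent_sum_pos[OF fin]; simp add: order_60)+
  ultimately show "exponent_sum 2 G = 15" "exponent_sum 3 G = 20" "exponent_sum 5 G = 24"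
    by presburger+
qed

text \<open>The order of the product is 1 or a prime and divides \<open>ord g * ord h\<close>, hence
  one of the two factors. Raising to that factor makes the order of one element divide the order of
  the other, which is impossible for distinct primes.\<close>

lemma ord_centralizer:
  assumes g: "g \<in> carrier G" "g \<noteq> \<one>" and h: "h \<in> centralizer G g" "h \<noteq> \<one>"
  shows "ord h = ord g"
proof (rule ccontr)
  assume ne: "ord h \<noteq> ord g"
  have hG: "h \<in> carrier G" and c: "g \<otimes> h = h \<otimes> g"
    using h(1) by (auto simp: centralizer_def)
  have p: "Factorial_Ring.prime (ord g)" "Factorial_Ring.prime (ord h)"
    using prime_ord g h hG by auto
  have ndvd: "\<not> ord h dvd ord g" "\<not> ord g dvd ord h"
    using p ne primes_dvd_imp_eq by metis+
  have pow: "(g \<otimes> h) [^] k = g [^] k \<otimes> h [^] k" for k :: nat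
    by (rule pow_mult_distrib[OF c g(1) hG])
  have "ord (g \<otimes> h) = 1 \<or> Factorial_Ring.prime (ord (g \<otimes> h))"
    using prime_ord[of "g \<otimes> h"] g(1) hG by (cases "g \<otimes> h = \<one>") auto
  moreover have "ord (g \<otimes> h) dvd ord g * ord h"
    by (rule ord_mul_divides[OF c g(1) hG])
  ultimately have "ord (g \<otimes> h) dvd ord g \<or> ord (g \<otimes> h) dvd ord h"
    by (auto simp: prime_dvd_mult_iff)
  then have "(g \<otimes> h) [^] ord g = \<one> \<or> (g \<otimes> h) [^] ord h = \<one>"
    using g(1) hG by (simp add: pow_eq_id)
  then have "h [^] ord g = \<one> \<or> g [^] ord h = \<one>"
    using g(1) hG by (simp add: pow)
  then show False using ndvd g(1) hG by (simp add: pow_eq_id)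
qed

lemma centralizer_subset: "centralizer G g \<subseteq> carrier G"
  by (auto simp: centralizer_def)

lemma finite_centralizer: "finite (centralizer G g)"
  using centralizer_subset fin by (rule finite_subset)

text \<open>By \<open>ord_centralizer\<close> the centralizer is a p-group for p =
  \<open>ord g\<close>, and the powers of 2, 3, 5 dividing 60 are at most 4, 3, 5.\<close>

lemma card_centralizer:
  assumes g: "g \<in> carrier G" "g \<noteq> \<one>"
  shows "card (centralizer G g) \<le> 5" and "ord g = 2 \<Longrightarrow> card (centralizer G g) \<le> 4"
proof -
  define C where "C = centralizer G g"
  have sg: "subgroup C G" unfolding C_def using g(1) by (rule centralizer_subgroup)
  interpret C: group "G\<lparr>carrier := C\<rparr>" by (rule subgroup_imp_group[OF sg])
  have "\<exists>k. ord h dvd ord g ^ k" if "h \<in> C" for h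
  proof (cases "h = \<one>")
    case False
    then show ?thesis
      using ord_centralizer[OF g, of h] that by (intro exI[of _ 1]) (simp add: C_def)
  qed (auto intro: exI[of _ 0])
  then have "carrier (G\<lparr>carrier := C\<rparr>) \<subseteq> primary_elements (ord g) (G\<lparr>carrier := C\<rparr>)"
    by (auto simp: primary_elements_def ord_subgroup[OF sg])
  then obtain k where k: "card C = ord g ^ k"
    using C.order_eq_prime_power[OF _ prime_ord[OF g]] finite_centralizer[of g]
    by (auto simp: Coset.order_def C_def)
  have dvd: "ord g ^ k dvd 60"
    using lagrange[OF sg] order_60 k by (metis dvd_triv_right)
  have bound: "k \<le> m" if "\<not> ord g ^ Suc m dvd 60" for m
    using that dvd by (meson dvd_trans le_imp_power_dvd not_less_eq_eq)
  consider "ord g = 2" | "ord g = 3" | "ord g = 5"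
    using prime_ords[OF g(1)] ord_eq_1[OF g(1)] g(2) by auto
  then have *: "card C \<le> 5 \<and> (ord g = 2 \<longrightarrow> card C \<le> 4)"
  proof cases
    case 1
    then have "k \<le> 2" by (intro bound) simp
    then have "(2::nat) ^ k \<le> 2 ^ 2" by (intro power_increasing) auto
    then show ?thesis using k 1 by simp
  next
    case 2
    then have "k \<le> 1" by (intro bound) simp
    then have "(3::nat) ^ k \<le> 3 ^ 1" by (intro power_increasing) auto
    then show ?thesis using k 2 by simp
  next
    case 3
    then have "k \<le> 1" by (intro bound) simp
    then have "(5::nat) ^ k \<le> 5 ^ 1" by (intro power_increasing) auto
    then show ?thesis using k 3 by simp
  qed
  then show "card (centralizer G g) \<le> 5" and "ord g = 2 \<Longrightarrow> card (centralizer G g) \<le> 4"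
    by (auto simp: C_def)
qed

lemma card_conj_class:
  assumes g: "g \<in> carrier G"
  shows "card ((\<lambda>h. h \<otimes> g \<otimes> inv h) ` carrier G) * card (centralizer G g) = 60"
proof -
  have "orbit G (\<lambda>g. \<lambda>h \<in> carrier G. g \<otimes> h \<otimes> inv g) g = (\<lambda>h. h \<otimes> g \<otimes> inv h) ` carrier G"
    using g by (auto simp: orbit_def)
  then show ?thesis
    using group_action.orbit_stabilizer_theorem[OF action_by_conjugation g] order_60
    by (simp add: centralizer_eq_stabilizer[OF g])
qed

section \<open>Involutions and their centralizers\<close>

definition involutions :: "'a set" where
  "involutions = {t \<in> carrier G. ord t = 2}"

lemma involution_ne_one: "t \<in> involutions \<Longrightarrow> t \<noteq> \<one>"
  by (auto simp: involutions_def)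

lemma card_involutions: "card involutions = 15"
  using exponent_sum_eq_card_ord[of 2] exponent_sums(1) by (simp add: involutions_def)

lemma finite_involutions: "finite involutions"
  using fin by (simp add: involutions_def)

text \<open>The class of t lies among the 15 involutions, so the centralizer has at least 60 / 15 =
  4 elements, which meets the bound of \<open>card_centralizer\<close>.\<close>

lemma card_centralizer_involution:
  assumes t: "t \<in> involutions"
  shows "card (centralizer G t) = 4"
proof -
  have tG: "t \<in> carrier G" "ord t = 2" using t by (auto simp: involutions_def)
  let ?K = "(\<lambda>h. h \<otimes> t \<otimes> inv h) ` carrier G"
  have "?K \<subseteq> involutions"
    using tG by (auto simp: involutions_def ord_conj)
  then have "card ?K \<le> 15"
    using card_mono[OF finite_involutions] card_involutions by metis
  then have "60 \<le> 15 * card (centralizer G t)"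
    unfolding card_conj_class[OF tG(1), symmetric] by (rule mult_le_mono1)
  then show ?thesis
    using card_centralizer(2)[OF tG(1) involution_ne_one[OF t] tG(2)] by simp
qed

text \<open>All squares in the centralizer of t are trivial, so it is abelian and lies in the
  centralizer of each of its involutions; both have 4 elements. Hence the involutions fall into
  blocks of three sharing a centralizer.\<close>

lemma centralizer_involution_iff:
  assumes t: "t \<in> involutions"
  shows "s \<in> centralizer G t - {\<one>} \<longleftrightarrow> s \<in> involutions \<and> centralizer G s = centralizer G t"
proof
  have tG: "t \<in> carrier G" "ord t = 2" using t by (auto simp: involutions_def)
  have sg: "subgroup (centralizer G t) G" using tG(1) by (rule centralizer_subgroup)
  assume s: "s \<in> centralizer G t - {\<one>}"
  have sq: "x \<otimes> x = \<one>" if "x \<in> centralizer G t" for x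
  proof (cases "x = \<one>")
    case False
    then have "ord x = 2"
      using ord_centralizer[OF tG(1) involution_ne_one[OF t] that] tG(2) by simp
    moreover have "x \<in> carrier G" using that centralizer_subset by auto
    ultimately show ?thesis using pow_ord_eq_1[of x] by (simp add: numeral_2_eq_2)
  qed simp
  have comm: "x \<otimes> y = y \<otimes> x" if x: "x \<in> centralizer G t" and y: "y \<in> centralizer G t" for x y
  proof -
    have c: "x \<in> carrier G" "y \<in> carrier G" using x y centralizer_subset by auto
    have "(x \<otimes> y) \<otimes> (x \<otimes> y) = \<one>" using sq subgroup.m_closed[OF sg x y] by blast
    then have "inv (x \<otimes> y) = x \<otimes> y" using c by (intro inv_equality) auto
    moreover have "inv x = x" "inv y = y" using c sq[OF x] sq[OF y] by (auto intro: inv_equality)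
    ultimately show ?thesis using c by (simp add: inv_mult_group)
  qed
  have sI: "s \<in> involutions"
    using ord_centralizer[OF tG(1) involution_ne_one[OF t], of s] tG(2) s centralizer_subset
    by (auto simp: involutions_def)
  moreover have "centralizer G t \<subseteq> centralizer G s"
    using comm s by (auto simp: centralizer_def[of G s] dest: subsetD[OF centralizer_subset])
  ultimately show "s \<in> involutions \<and> centralizer G s = centralizer G t"
    using card_subset_eq[OF finite_centralizer, of "centralizer G t" s]
      card_centralizer_involution[OF t] card_centralizer_involution[of s] by simp
next
  assume s: "s \<in> involutions \<and> centralizer G s = centralizer G t"
  then have "s \<in> carrier G" by (simp add: involutions_def)
  then have "s \<in> centralizer G s" by (simp add: centralizer_def)
  then show "s \<in> centralizer G t - {\<one>}" using s involution_ne_one by auto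
qed

text \<open>Having order 4, these are Sylow 2-subgroups of G.\<close>

definition involution_centralizers :: "'a set set" where
  "involution_centralizers = centralizer G ` involutions"

lemma card_involution_centralizers: "card involution_centralizers = 5"
proof -
  have "card {s \<in> involutions. centralizer G s = V} = 3" if V: "V \<in> involution_centralizers" for V
  proof -
    obtain t where t: "t \<in> involutions" "V = centralizer G t"
      using V by (auto simp: involution_centralizers_def)
    have "{s \<in> involutions. centralizer G s = V} = V - {\<one>}"
      using centralizer_involution_iff[OF t(1)] t(2) by auto
    moreover have "\<one> \<in> V"
      using t by (simp add: centralizer_def involutions_def)
    ultimately show ?thesis
      using card_centralizer_involution[OF t(1)] t(2) by simp
  qed
  moreover have "card involutions =
      (\<Sum>V\<in>involution_centralizers. card {s \<in> involutions. centralizer G s = V})"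
    using sum.image_gen[OF finite_involutions, of "\<lambda>_. 1::nat" "centralizer G"]
    by (simp add: involution_centralizers_def)
  ultimately have "card involutions = (\<Sum>V\<in>involution_centralizers. 3)" by simp
  then show ?thesis using card_involutions by simp
qed

text \<open>G permutes the five centralizers by conjugation. Of faithfulness only the raw material
  is recorded: an element acting trivially normalizes the centralizer of each involution t, so it
  conjugates t into that centralizer. Counting in \<open>iso_alt_group_5\<close> turns this into a
  trivial kernel.\<close>

lemma ex_faithful_hom_sym_5:
  obtains F where "F \<in> hom G (sym_group 5)"
    "\<And>g t. g \<in> carrier G \<Longrightarrow> t \<in> involutions \<Longrightarrow> F g = id \<Longrightarrow> g \<otimes> t \<otimes> inv g \<in> centralizer G t"
proof -
  let ?S = "involution_centralizers"
  define \<kappa> where "\<kappa> g V = (\<lambda>y. g \<otimes> y \<otimes> inv g) ` V" for g V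
  have \<kappa>_cent: "\<kappa> g (centralizer G t) = centralizer G (g \<otimes> t \<otimes> inv g)"
    if "g \<in> carrier G" "t \<in> carrier G" for g t
    unfolding \<kappa>_def using centralizer_conj[OF that] by simp
  have \<kappa>_S: "\<kappa> g V \<in> ?S" if "g \<in> carrier G" "V \<in> ?S" for g V
    using that \<kappa>_cent by (auto simp: involution_centralizers_def involutions_def ord_conj)
  have \<kappa>_mult: "\<kappa> (g \<otimes> h) V = \<kappa> g (\<kappa> h V)" if "g \<in> carrier G" "h \<in> carrier G" "V \<in> ?S" for g h V
  proof -
    have "V \<subseteq> carrier G"
      using that(3) centralizer_subset by (auto simp: involution_centralizers_def)
    then show ?thesis
      unfolding \<kappa>_def image_image using that(1,2)
      by (intro image_cong) (auto simp: inv_mult_group m_assoc subset_iff)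
  qed
  have \<kappa>_one: "\<kappa> \<one> V = V" if "V \<in> ?S" for V
  proof -
    have "V \<subseteq> carrier G"
      using that centralizer_subset by (auto simp: involution_centralizers_def)
    then have "\<kappa> \<one> V = (\<lambda>y. y) ` V"
      unfolding \<kappa>_def by (intro image_cong) auto
    then show ?thesis by simp
  qed
  obtain b where b: "bij_betw b {1..5::nat} ?S"
    using ex_bij_betw_nat_finite_1[of ?S] card_involution_centralizers finite_involutions
    by (auto simp: involution_centralizers_def)
  \<comment> \<open>The numbering b carries the action over to {1..5}; fixing all other numbers is
    what \<open>permutes\<close> demands.\<close>
  define F where "F g i = (if i \<in> {1..5} then inv_into {1..5} b (\<kappa> g (b i)) else i)" for g i
  have bS: "b i \<in> ?S" if "i \<in> {1..5}" for i
    using b that by (auto simp: bij_betw_def)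
  have bF: "b (F g i) = \<kappa> g (b i)" and F5: "F g i \<in> {1..5}"
    if i: "i \<in> {1..5}" and g: "g \<in> carrier G" for g i
  proof -
    have *: "\<kappa> g (b i) \<in> b ` {1..5}"
      using \<kappa>_S[OF g bS[OF i]] bij_betw_imp_surj_on[OF b] by blast
    have F: "F g i = inv_into {1..5} b (\<kappa> g (b i))" unfolding F_def if_P[OF i] ..
    show "b (F g i) = \<kappa> g (b i)" unfolding F using * by (rule f_inv_into_f)
    show "F g i \<in> {1..5}" unfolding F using * by (rule inv_into_into)
  qed
  have F_mult: "F (g \<otimes> h) = F g \<circ> F h" if gh: "g \<in> carrier G" "h \<in> carrier G" for g h
  proof
    fix i
    show "F (g \<otimes> h) i = (F g \<circ> F h) i"
    proof (cases "i \<in> {1..5}")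
      case True
      have "b (F (g \<otimes> h) i) = b (F g (F h i))"
        using True gh by (simp only: bF F5 m_closed \<kappa>_mult bS)
      then show ?thesis
        using b True gh F5 by (metis bij_betw_imp_inj_on comp_apply inj_onD m_closed)
    qed (auto simp: F_def)
  qed
  have F_one: "F \<one> = id"
    using b by (auto simp: F_def fun_eq_iff \<kappa>_one bS bij_betw_inv_into_left simp del: atLeastAtMost_iff)
  have F_perm: "F g permutes {1..5}" if g: "g \<in> carrier G" for g
  proof -
    have "F g \<circ> F (inv g) = id" "F (inv g) \<circ> F g = id"
      using F_mult[of g "inv g"] F_mult[of "inv g" g] g F_one by simp_all
    then have "bij (F g)" by (intro o_bij)
    then show ?thesis by (auto simp: permutes_def F_def bij_iff)
  qed
  show ?thesis
  proof (rule that[of F])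
    show "F \<in> hom G (sym_group 5)"
      using F_perm F_mult by (auto intro!: homI simp: sym_group_carrier sym_group_mult)
  next
    fix g t assume g: "g \<in> carrier G" and t: "t \<in> involutions" and "F g = id"
    obtain i where i: "i \<in> {1..5}" "b i = centralizer G t"
      using b t by (metis (no_types, lifting) bij_betw_def imageE image_eqI involution_centralizers_def)
    have "\<kappa> g (centralizer G t) = centralizer G t"
      using bF[OF i(1) g] i(2) \<open>F g = id\<close> by simp
    moreover have "t \<in> centralizer G t"
      using t by (simp add: centralizer_def involutions_def)
    ultimately show "g \<otimes> t \<otimes> inv g \<in> centralizer G t"
      unfolding \<kappa>_def by blast
  qed
qed

text \<open>The elements carrying t to s, if there are any, form one left coset of the centralizer
  of t.\<close>

lemma card_conj_to:
  assumes t: "t \<in> involutions"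
  shows "card {g \<in> carrier G. g \<otimes> t \<otimes> inv g = s} \<le> 4"
proof (cases "{g \<in> carrier G. g \<otimes> t \<otimes> inv g = s} = {}")
  case True
  show ?thesis unfolding True by simp
next
  case False
  then obtain g0 where g0: "g0 \<in> carrier G" "g0 \<otimes> t \<otimes> inv g0 = s" by auto
  have tG: "t \<in> carrier G" using t by (simp add: involutions_def)
  have "inv g0 \<otimes> g \<in> centralizer G t" if g: "g \<in> carrier G" "g \<otimes> t \<otimes> inv g = s" for g
  proof -
    have "g \<otimes> t = g0 \<otimes> t \<otimes> inv g0 \<otimes> g"
      using g g0 tG by (metis inv_closed inv_solve_right m_closed)
    then have "inv g0 \<otimes> (g \<otimes> t) = t \<otimes> (inv g0 \<otimes> g)"
      using g(1) g0(1) tG by (simp add: m_assoc) (simp flip: m_assoc)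
    then show ?thesis
      using g(1) g0(1) tG by (simp add: centralizer_def m_assoc)
  qed
  moreover have "inj_on (\<lambda>g. inv g0 \<otimes> g) {g \<in> carrier G. g \<otimes> t \<otimes> inv g = s}"
    using g0(1) by (auto simp: inj_on_def)
  ultimately show ?thesis
    using card_inj_on_le[of "\<lambda>g. inv g0 \<otimes> g" _ "centralizer G t"] finite_centralizer
    by (simp add: card_centralizer_involution[OF t] image_subset_iff)
qed

text \<open>A nontrivial kernel would be too large: it contains the identity and a class of at least
  60 / 5 = 12 elements, yet at most 3 * 4 = 12 elements carry an involution t to a nonidentity
  element of its centralizer. The elements acting evenly form a subgroup with all 45
  non-involutions, so they are all of G, and the image has the size 60 of the alternating
  group.\<close>

theorem iso_alt_group_5: "G \<cong> alt_group 5"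
proof -
  obtain F where F: "F \<in> hom G (sym_group 5)"
    and F_id: "\<And>g t. g \<in> carrier G \<Longrightarrow> t \<in> involutions \<Longrightarrow> F g = id \<Longrightarrow>
      g \<otimes> t \<otimes> inv g \<in> centralizer G t"
    using ex_faithful_hom_sym_5 by blast
  interpret F: group_hom G "sym_group 5" F
    using F sym_group_is_group[of 5] by (intro group_hom.intro group_hom_axioms.intro is_group)
  \<comment> \<open>Values of F are treated as functions, through \<open>id\<close> and composition;
    these rules would rewrite them into operations of \<open>sym_group 5\<close>.\<close>
  note F.hom_one [simp del] F.hom_mult [simp del] F.hom_inv [simp del]
  have F_mult: "F (g \<otimes> h) = F g \<circ> F h" if "g \<in> carrier G" "h \<in> carrier G" for g h
    using F.hom_mult[OF that] by (simp add: sym_group_mult)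
  have F_one: "F \<one> = id"
    using F.hom_one by (simp add: sym_group_one)
  have F_inv: "F h \<circ> F (inv h) = id" if "h \<in> carrier G" for h
    using F_mult[of h "inv h"] that F_one by simp
  define K where "K = {g \<in> carrier G. F g = id}"
  have "g = \<one>" if "g \<in> K" for g
  proof (rule ccontr)
    assume "g \<noteq> \<one>"
    have g: "g \<in> carrier G" "F g = id" using that by (auto simp: K_def)
    let ?C = "(\<lambda>h. h \<otimes> g \<otimes> inv h) ` carrier G"
    have "F (h \<otimes> g \<otimes> inv h) = id" if h: "h \<in> carrier G" for h
    proof -
      have "F (h \<otimes> g \<otimes> inv h) = F h \<circ> F g \<circ> F (inv h)"
        using F_mult[of "h \<otimes> g" "inv h"] F_mult[of h g] g(1) h by simp
      then show ?thesis using F_inv[OF h] g(2) by (simp only: comp_id)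
    qed
    then have "?C \<subseteq> K"
      using g(1) by (auto simp: K_def)
    moreover have "\<one> \<in> K" by (simp add: K_def F_one)
    moreover have "\<one> \<notin> ?C"
    proof
      assume "\<one> \<in> ?C"
      then obtain h where "h \<in> carrier G" "\<one> = h \<otimes> g \<otimes> inv h" by blast
      then show False using conj_eq_one_iff[of h g] g(1) \<open>g \<noteq> \<one>\<close> by simp
    qed
    moreover have "finite K" using fin by (simp add: K_def)
    ultimately have "card (insert \<one> ?C) \<le> card K"
      by (intro card_mono) auto
    then have "card ?C < card K"
      by (simp only: card_insert_disjoint finite_imageI fin Suc_le_eq \<open>\<one> \<notin> ?C\<close> not_False_eq_True)
    have "60 \<le> card ?C * 5"
      unfolding card_conj_class[OF g(1), symmetric]
      using card_centralizer(1)[OF g(1) \<open>g \<noteq> \<one>\<close>] by (rule mult_le_mono2)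
    then have "12 < card K" using \<open>card ?C < card K\<close> by linarith
    obtain t where t: "t \<in> involutions"
      using card_involutions by (metis card.empty ex_in_conv zero_neq_numeral)
    have "K \<subseteq> (\<Union>s\<in>centralizer G t - {\<one>}. {h \<in> carrier G. h \<otimes> t \<otimes> inv h = s})"
      using F_id[OF _ t] t conj_eq_one_iff involution_ne_one[OF t]
      by (auto simp: K_def involutions_def)
    then have "card K \<le> card (\<Union>s\<in>centralizer G t - {\<one>}. {h \<in> carrier G. h \<otimes> t \<otimes> inv h = s})"
      using fin finite_centralizer by (intro card_mono) auto
    also have "\<dots> \<le> (\<Sum>s\<in>centralizer G t - {\<one>}. card {h \<in> carrier G. h \<otimes> t \<otimes> inv h = s})"
      using finite_centralizer by (intro card_UN_le) simp
    also have "\<dots> \<le> card (centralizer G t - {\<one>}) * 4"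
      using sum_bounded_above[of "centralizer G t - {\<one>}" _ "4::nat"] card_conj_to[OF t] by simp
    also have "\<dots> = 12"
      using card_centralizer_involution[OF t] t by (simp add: centralizer_def involutions_def)
    finally show False using \<open>12 < card K\<close> by simp
  qed
  then have "F g = id \<Longrightarrow> g = \<one>" if "g \<in> carrier G" for g
    using that by (simp add: K_def)
  then have inj: "inj_on F (carrier G)"
    by (intro F.inj_on_one_iff[THEN iffD2]) (auto simp: sym_group_one)
  have perm: "permutation (F g)" if "g \<in> carrier G" for g
    using F.hom_closed[OF that] by (rule sym_group_carrier')
  define A where "A = {g \<in> carrier G. evenperm (F g)}"
  have even_mult: "evenperm (F (g \<otimes> h)) \<longleftrightarrow> (evenperm (F g) \<longleftrightarrow> evenperm (F h))"
    if "g \<in> carrier G" "h \<in> carrier G" for g h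
    using that by (simp add: F_mult evenperm_comp perm)
  have sg: "subgroup A G"
  proof
    show "inv x \<in> A" if "x \<in> A" for x
      using that even_mult[of x "inv x"] by (auto simp: A_def F_one evenperm_id)
  qed (auto simp: A_def even_mult F_one evenperm_id)
  txt \<open>An element of odd order is a square.\<close>
  have odd: "g \<in> A" if g: "g \<in> carrier G" "odd (ord g)" for g
  proof -
    obtain k where k: "ord g = 2 * k + 1" using g(2) by (auto elim: oddE)
    have "g [^] (k + 1) \<otimes> g [^] (k + 1) = g [^] ((k + 1) + (k + 1))"
      by (rule nat_pow_mult[OF g(1)])
    also have "(k + 1) + (k + 1) = Suc (ord g)" using k by simp
    also have "g [^] Suc (ord g) = g" using g(1) by simp
    finally show ?thesis
      using even_mult[of "g [^] (k + 1)" "g [^] (k + 1)"] g(1) unfolding A_def by auto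
  qed
  have "carrier G - involutions \<subseteq> A"
  proof
    fix x assume "x \<in> carrier G - involutions"
    then have x: "x \<in> carrier G" "ord x \<noteq> 2" by (auto simp: involutions_def)
    then have "odd (ord x)" using prime_ords[of x] by auto
    then show "x \<in> A" using odd x(1) by blast
  qed
  then have "card (carrier G - involutions) \<le> card A"
    using fin by (intro card_mono) (auto simp: A_def)
  moreover have "card (carrier G - involutions) = 45"
    using card_Diff_subset[OF finite_involutions, of "carrier G"] card_involutions order_60
    by (auto simp: Coset.order_def involutions_def)
  ultimately have "45 \<le> card A" by simp
  moreover have "card (rcosets A) * card A = 60"
    using lagrange[OF sg] order_60 by simp
  \<comment> \<open>Two cosets would already need 2 * 45 > 60 elements.\<close>
  moreover from calculation have "\<not> 2 \<le> card (rcosets A)"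
    using mult_le_mono[of 2 "card (rcosets A)" 45 "card A"] by linarith
  moreover from calculation have "card (rcosets A) \<noteq> 0" by (intro notI) simp
  ultimately have "card (rcosets A) = 1" by linarith
  then have "card A = card (carrier G)"
    using \<open>card (rcosets A) * card A = 60\<close> order_60 by (simp add: Coset.order_def)
  then have "A = carrier G"
    using fin by (intro card_subset_eq) (auto simp: A_def)
  then have "F ` carrier G \<subseteq> carrier (alt_group 5)"
    using F.hom_closed by (auto simp: A_def alt_group_carrier sym_group_carrier)
  moreover have card_alt: "card (carrier (alt_group 5)) = 60"
    using alt_group_card_carrier[of 5] by (simp add: fact_numeral)
  moreover have "card (F ` carrier G) = 60"
    using inj order_60 by (simp add: card_image Coset.order_def)
  moreover have "finite (carrier (alt_group 5))"
    using card_alt by (intro card_ge_0_finite) simp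
  ultimately have "F ` carrier G = carrier (alt_group 5)"
    by (intro card_subset_eq) auto
  then have "F \<in> iso G (alt_group 5)"
    using inj F_mult by (auto simp: iso_def bij_betw_def hom_def alt_group_mult)
  then show ?thesis by (auto simp: is_iso_def)
qed

end

text \<open>The function \<open>v\<close> counts the prime factors of a divisor of 60 with
  multiplicity. Over the element orders it sums to 15 + 20 + 24 = 59 and is at least 1 at each of
  the 59 nonidentity elements, so it equals 1 there.\<close>

lemma (in group) prime_ords_of_exponent_sums:
  assumes n: "Coset.order G = 60"
    and e: "exponent_sum 2 G = 15" "exponent_sum 3 G = 20" "exponent_sum 5 G = 24"
    and g: "g \<in> carrier G"
  shows "ord g \<in> {1, 2, 3, 5}"
proof (cases "g = \<one>")
  case False
  have fin: "finite (carrier G)"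
    using n by (intro card_ge_0_finite) (simp add: Coset.order_def)
  define v where "v k = multiplicity 2 k + multiplicity 3 k + multiplicity 5 k" for k :: nat
  have ord60: "ord h dvd 60" if "h \<in> carrier G" for h
    using ord_dvd_group_order[OF that] n by simp
  have prime: "p = 2 \<or> p = 3 \<or> p = 5" if p: "Factorial_Ring.prime p" "p dvd 60" for p :: nat
  proof -
    have "p dvd 2 * (2 * (3 * 5))" using p(2) by simp
    then have "p dvd 2 \<or> p dvd 3 \<or> p dvd 5"
      using p(1) by (simp only: prime_dvd_mult_iff) blast
    then show ?thesis
      using p(1) primes_dvd_imp_eq[of p 2] primes_dvd_imp_eq[of p 3] primes_dvd_imp_eq[of p 5]
      by auto
  qed
  have pos: "1 \<le> v k" if k: "k dvd 60" "k \<noteq> 1" for k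
  proof -
    obtain p where p: "Factorial_Ring.prime p" "p dvd k"
      using k(2) prime_factor_nat by blast
    have "k > 0" using k(1) by (intro Nat.gr0I) simp
    then have "multiplicity p k > 0"
      using p by (simp add: prime_multiplicity_gt_zero_iff)
    moreover have "p = 2 \<or> p = 3 \<or> p = 5"
      using prime[OF p(1)] p(2) k(1) dvd_trans by blast
    ultimately show ?thesis by (auto simp: v_def)
  qed
  have "(\<Sum>h\<in>carrier G. v (ord h)) = 59"
    using e by (simp add: v_def exponent_sum_def sum.distrib)
  moreover have "(\<Sum>h\<in>carrier G. v (ord h)) = v (ord \<one>) + (\<Sum>h\<in>carrier G - {\<one>}. v (ord h))"
    using fin by (intro sum.remove) auto
  moreover have "v (ord \<one>) = 0" by (simp add: v_def)
  ultimately have "(\<Sum>h\<in>carrier G - {\<one>}. v (ord h)) = (\<Sum>h\<in>carrier G - {\<one>}. 1)"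
    using n by (simp add: Coset.order_def)
  moreover have "1 \<le> v (ord h)" if "h \<in> carrier G - {\<one>}" for h
    using that ord60[of h] ord_eq_1[of h] by (intro pos) auto
  moreover have "finite (carrier G - {\<one>})" using fin by simp
  ultimately have "\<not> (\<exists>h\<in>carrier G - {\<one>}. 1 < v (ord h))"
    using sum_strict_mono_ex1[of "carrier G - {\<one>}" "\<lambda>_. 1" "\<lambda>h. v (ord h)"] by auto
  then have v1: "v (ord g) \<le> 1"
    using g False by (auto simp: not_less)
  obtain p where p: "Factorial_Ring.prime p" "p dvd ord g"
    using False ord_eq_1[OF g] prime_factor_nat by blast
  then obtain m where m: "ord g = p * m" by (auto elim: dvdE)
  have nz: "p \<noteq> 0" "m \<noteq> 0" using m ord_ge_1[OF fin g] by (auto intro: Nat.gr0I)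
  have dvd: "p dvd 60" "m dvd 60" using ord60[OF g] m by (auto dest: dvd_mult_left dvd_mult_right)
  \<comment> \<open>As \<open>v\<close> is additive and p already contributes 1, nothing is left for
    the cofactor m.\<close>
  have "v (ord g) = v p + v m"
    using nz by (simp add: v_def m prime_elem_multiplicity_mult_distrib)
  moreover have "1 \<le> v p" using pos[OF dvd(1)] prime_gt_1_nat[OF p(1)] by simp
  ultimately have "m = 1" using v1 pos[OF dvd(2)] by linarith
  then show ?thesis using m prime[OF p(1) dvd(1)] by auto
qed simp

section \<open>The group PSL(2,5)\<close>

definition mat2 :: "'a \<Rightarrow> 'a \<Rightarrow> 'a \<Rightarrow> 'a \<Rightarrow> 'a::zero ^ 2 ^ 2" where
  "mat2 a b c d = vector [vector [a, b], vector [c, d]]"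

lemma mat2_nth [simp]:
  "mat2 a b c d $ 1 $ 1 = a" "mat2 a b c d $ 1 $ 2 = b"
  "mat2 a b c d $ 2 $ 1 = c" "mat2 a b c d $ 2 $ 2 = d"
  by (simp_all add: mat2_def)

lemma mat2_cases: "\<exists>a b c d. A = mat2 a b c d"
  by (intro exI[of _ "A $ 1 $ 1"] exI[of _ "A $ 1 $ 2"] exI[of _ "A $ 2 $ 1"] exI[of _ "A $ 2 $ 2"])
    (simp add: vec_eq_iff forall_2)

lemma mat2_eq_iff: "mat2 a b c d = mat2 a' b' c' d' \<longleftrightarrow> a = a' \<and> b = b' \<and> c = c' \<and> d = d'"
  by (auto simp: vec_eq_iff forall_2)

lemma mat2_mult:
  fixes a :: "'a::comm_ring_1"
  shows "mat2 a b c d ** mat2 a' b' c' d' =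
    mat2 (a * a' + b * c') (a * b' + b * d') (c * a' + d * c') (c * b' + d * d')"
  by (simp add: vec_eq_iff forall_2 matrix_matrix_mult_def sum_2)

lemma mat_1_eq_mat2: "mat 1 = mat2 1 0 0 (1::'a::comm_ring_1)"
  by (simp add: vec_eq_iff forall_2 mat_def)

lemma det_mat2: "det (mat2 a b c (d::'a::comm_ring_1)) = a * d - b * c"
  by (simp add: det_2)

lemma SL_simps:
  "carrier SL = {A. det A = 1}" "monoid.mult SL = (**)" "one SL = mat 1"
  by (simp_all add: SL_def)

lemma group_SL_2: "group (SL :: ('a::comm_ring_1 ^ 2 ^ 2) monoid)"
proof (rule groupI)
  fix A :: "'a ^ 2 ^ 2" assume A: "A \<in> carrier SL"
  obtain a b c d where abcd: "A = mat2 a b c d" using mat2_cases by blast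
  \<comment> \<open>The adjugate is a left inverse because the determinant is 1.\<close>
  have "mat2 d (- b) (- c) a ** A = mat 1" "det (mat2 d (- b) (- c) a) = 1"
    using A by (simp_all add: abcd SL_simps det_mat2 mat2_mult mat_1_eq_mat2 mat2_eq_iff algebra_simps)
  then show "\<exists>B\<in>carrier SL. B \<otimes>\<^bsub>SL\<^esub> A = \<one>\<^bsub>SL\<^esub>"
    by (auto simp: SL_simps)
qed (auto simp: SL_simps det_mul matrix_mul_assoc)

text \<open>The matrix \<open>x A - y\<close>, where \<open>A\<close> has the rows \<open>(a, b)\<close> and \<open>(c, d)\<close>.  If \<open>A\<close>
  has determinant 1, its powers stay in this form by the theorem of Cayley and Hamilton.\<close>
definition lin2 :: "'a::comm_ring_1 \<Rightarrow> 'a \<Rightarrow> 'a \<Rightarrow> 'a \<Rightarrow> 'a \<Rightarrow> 'a \<Rightarrow> 'a ^ 2 ^ 2" where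
  "lin2 a b c d x y = mat2 (x * a - y) (x * b) (x * c) (x * d - y)"

text \<open>By Cayley-Hamilton A^2 = t A - 1 with the trace t = a + d, so (x A - y) A = (x t - y) A
  - x. The coefficients of the powers therefore depend on the trace alone.\<close>

lemma lin2_mult:
  assumes "a * d - b * c = 1"
  shows "lin2 a b c d x y ** mat2 a b c d = lin2 a b c d (x * (a + d) - y) x"
proof -
  have bc: "b * c = a * d - 1" using assms by (simp add: algebra_simps)
  have "(x * a - y) * a + x * b * c = (x * (a + d) - y) * a - x"
    unfolding mult.assoc bc by (simp add: algebra_simps)
  moreover have "x * c * b + (x * d - y) * d = (x * (a + d) - y) * d - x"
    unfolding mult.assoc mult.commute[of c b] bc by (simp add: algebra_simps)
  ultimately show ?thesis
    by (simp add: lin2_def mat2_mult mat2_eq_iff) (simp add: algebra_simps)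
qed

text \<open>Signed representatives suit the case distinction on the trace, where t and -t need the
  same exponent.\<close>

lemma mod_5_cases: "x = 0 \<or> x = 1 \<or> x = 2 \<or> x = -2 \<or> x = (-1 :: 5)"
proof (cases x)
  case (of_int z)
  then have "z = 0 \<or> z = 1 \<or> z = 2 \<or> z = 3 \<or> z = 4" by auto
  then show ?thesis using of_int(1) by auto
qed

section \<open>The quotient by the centre\<close>

lemma (in group) group_center_normal: "group_center G \<lhd> G"
proof -
  have C: "group_center G \<subseteq> carrier G" by (auto simp: group_center_def)
  have sg: "subgroup (group_center G) G"
  proof
    fix x y assume xy: "x \<in> group_center G" "y \<in> group_center G"
    then have c: "x \<in> carrier G" "y \<in> carrier G" using C by auto
    have "x \<otimes> y \<otimes> g = g \<otimes> (x \<otimes> y)" if g: "g \<in> carrier G" for g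
    proof -
      have "x \<otimes> g = g \<otimes> x" "y \<otimes> g = g \<otimes> y" using xy g by (auto simp: group_center_def)
      then show ?thesis using c g by (metis m_assoc)
    qed
    then show "x \<otimes> y \<in> group_center G" using c by (simp add: group_center_def)
  next
    fix x assume x: "x \<in> group_center G"
    then have c: "x \<in> carrier G" using C by auto
    have "inv x \<otimes> g = g \<otimes> inv x" if g: "g \<in> carrier G" for g
    proof -
      have "x \<otimes> g = g \<otimes> x" using x g by (auto simp: group_center_def)
      then show ?thesis using c g by (metis inv_closed inv_solve_left inv_solve_right m_assoc m_closed)
    qed
    then show "inv x \<in> group_center G" using c by (simp add: group_center_def)
  qed (auto simp: group_center_def)
  show ?thesis
  proof (rule normal_invI[OF sg])
    fix g h assume gh: "g \<in> carrier G" "h \<in> group_center G"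
    then have "g \<otimes> h = h \<otimes> g" "h \<in> carrier G" by (auto simp: group_center_def)
    then show "g \<otimes> h \<otimes> inv g \<in> group_center G" using gh by (simp add: m_assoc)
  qed
qed

lemma (in normal) ord_Mod_dvd:
  assumes "x \<in> carrier G" "x [^] n \<in> H"
  shows "group.ord (G Mod H) (H #> x) dvd n"
proof -
  interpret M: group "G Mod H" by (rule factorgroup_is_group)
  interpret h: group_hom G "G Mod H" "\<lambda>a. H #> a"
    using r_coset_hom_Mod by unfold_locales
  have "(H #> x) [^]\<^bsub>G Mod H\<^esub> n = H #> (x [^] n)"
    using h.hom_nat_pow[OF assms(1), of n] by simp
  also have "\<dots> = \<one>\<^bsub>G Mod H\<^esub>"
    using coset_join2[OF _ is_subgroup assms(2)] assms(1) by (simp add: FactGroup_def)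
  finally show ?thesis
    using M.pow_eq_id[OF h.hom_closed[OF assms(1)]] by simp
qed

section \<open>SL(2,5): order, centre and central powers\<close>

abbreviation SL_2_5 :: "(5 ^ 2 ^ 2) monoid" where
  "SL_2_5 \<equiv> SL"

text \<open>This turns equations over the type \<open>5\<close> into integer congruences, which can
  be evaluated.\<close>

lemma of_int_mod_5_eq_iff: "(of_int z :: 5) = of_int w \<longleftrightarrow> z mod 5 = w mod 5"
proof -
  have "(of_int z :: 5) = Abs_bit1 (z mod int CARD(5))" for z
    by (rule bit1.of_int_eq)
  then have "(of_int z :: 5) = of_int w \<longleftrightarrow> z mod int CARD(5) = w mod int CARD(5)"
    by (simp add: Abs_bit1_inject)
  then show ?thesis by simp
qed

text \<open>The matrices correspond to the quadruples of residues 0 to 4 with a d - b c congruent to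
  1 modulo 5; the 5^4 candidates are sifted by evaluation.\<close>

lemma order_SL_2_5: "Coset.order SL_2_5 = 120"
proof -
  let ?L = "[0..4]"
  let ?Q = "List.product ?L (List.product ?L (List.product ?L ?L))"
  let ?P = "\<lambda>(a, b, c, d). (a * d - b * c) mod 5 = (1 :: int)"
  let ?f = "\<lambda>(a, b, c, d). mat2 (of_int a) (of_int b) (of_int c) (of_int d :: 5)"
  have L: "\<exists>z\<in>set ?L. x = of_int z" for x :: 5
  proof (cases x)
    case (of_int z)
    then show ?thesis by (intro bexI[of _ z]) auto
  qed
  have det_iff: "of_int a * of_int d - of_int b * of_int c = (1::5) \<longleftrightarrow> (a * d - b * c) mod 5 = 1" for a b c d
    using of_int_mod_5_eq_iff[of "a * d - b * c" 1] by simp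
  have "carrier SL_2_5 = ?f ` set (filter ?P ?Q)"
  proof (intro Set.set_eqI iffI)
    fix A assume A: "A \<in> carrier SL_2_5"
    obtain a b c d where abcd: "A = mat2 a b c d" using mat2_cases by blast
    obtain a' b' c' d' where *: "a' \<in> set ?L" "b' \<in> set ?L" "c' \<in> set ?L" "d' \<in> set ?L"
      "a = of_int a'" "b = of_int b'" "c = of_int c'" "d = of_int d'"
      using L by metis
    have "(a', b', c', d') \<in> set (filter ?P ?Q)"
      using A * by (simp add: abcd SL_simps det_mat2 det_iff)
    moreover have "A = ?f (a', b', c', d')" using * abcd by simp
    ultimately show "A \<in> ?f ` set (filter ?P ?Q)" by (rule rev_image_eqI)
  qed (auto simp: SL_simps det_mat2 det_iff)
  moreover have "inj_on ?f (set (filter ?P ?Q))"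
    by (auto simp: inj_on_def mat2_eq_iff of_int_mod_5_eq_iff)
  ultimately have "Coset.order SL_2_5 = card (set (filter ?P ?Q))"
    by (simp add: Coset.order_def card_image)
  also have "\<dots> = length (filter ?P ?Q)"
    by (intro distinct_card distinct_filter distinct_product) simp_all
  also have "\<dots> = 120" by code_simp
  finally show ?thesis .
qed

text \<open>Commuting with the two elementary matrices forces a scalar matrix; determinant 1 leaves
  the square roots of 1 modulo 5.\<close>

lemma group_center_SL_2_5:
  "group_center SL_2_5 = {mat2 1 0 0 1, mat2 (-1) 0 0 (-1)}"
proof (intro Set.set_eqI iffI)
  fix A assume A: "A \<in> group_center SL_2_5"
  obtain a b c d where abcd: "A = mat2 a b c d" using mat2_cases by blast
  have det: "a * d - b * c = 1"
    using A by (simp add: abcd group_center_def SL_simps det_mat2)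
  have "A ** mat2 1 1 0 1 = mat2 1 1 0 1 ** A" "A ** mat2 1 0 1 1 = mat2 1 0 1 1 ** A"
    using A by (auto simp: group_center_def SL_simps det_mat2)
  then have "c = 0" "b = 0" "a = d"
    by (auto simp: abcd mat2_mult mat2_eq_iff)
  then show "A \<in> {mat2 1 0 0 1, mat2 (-1) 0 0 (-1)}"
    using mod_5_cases[of a] det by (auto simp: abcd)
next
  fix A assume "A \<in> {mat2 1 0 0 1, mat2 (-1) 0 0 (-1 :: 5)}"
  then obtain s where s: "A = mat2 s 0 0 s" "s * s = 1" by auto
  have "A ** B = B ** A" for B
    using mat2_cases[of B] by (auto simp: s(1) mat2_mult mat2_eq_iff mult.commute)
  then show "A \<in> group_center SL_2_5"
    using s by (simp add: group_center_def SL_simps det_mat2)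
qed

text \<open>The trace t decides the exponent. Starting from the identity as (x, y) = (0, -1), the
  recursion of \<open>lin2_mult\<close> gives x = t, t^2 - 1 and t^4 - 3 t^2 + 1 at the powers 2, 3
  and 5. Modulo 5 these vanish at t = 0, at t = 1, -1 and at t = 2, -2 respectively; a power with x
  = 0 is scalar, here 1 or -1.\<close>

lemma SL_2_5_power_central:
  assumes A: "A \<in> carrier SL_2_5"
  shows "\<exists>n\<in>{2, 3, 5 :: nat}. A [^]\<^bsub>SL_2_5\<^esub> n \<in> group_center SL_2_5"
proof -
  obtain a b c d where abcd: "A = mat2 a b c d" using mat2_cases by blast
  have det: "a * d - b * c = 1" using A by (simp add: abcd SL_simps det_mat2)
  let ?l = "lin2 a b c d"
  have pow_0: "A [^]\<^bsub>SL_2_5\<^esub> (0::nat) = ?l 0 (-1)"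
    by (simp add: SL_simps mat_1_eq_mat2 lin2_def)
  have pow_Suc: "A [^]\<^bsub>SL_2_5\<^esub> Suc n = ?l (x * (a + d) - y) x"
    if "A [^]\<^bsub>SL_2_5\<^esub> n = ?l x y" for n x y
    using that lin2_mult[OF det, of x y] by (simp add: SL_simps abcd)
  have central: "?l 0 1 \<in> group_center SL_2_5" "?l 0 (-1) \<in> group_center SL_2_5"
    by (auto simp: group_center_SL_2_5 lin2_def)
  have mod_5: "(5 :: 5) = 0" "(4 :: 5) = -1" by simp_all
  \<comment> \<open>This is the second power; each further \<open>pow_Suc\<close> adds one factor
    A.\<close>
  note pow = pow_0[THEN pow_Suc, THEN pow_Suc]
  consider "a + d = 0" | "a + d = 1" | "a + d = 2" | "a + d = -2" | "a + d = -1"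
    using mod_5_cases by blast
  then show ?thesis
  proof cases
    case 1
    then have "A [^]\<^bsub>SL_2_5\<^esub> (2::nat) = ?l 0 1"
      using pow by (simp add: numeral_2_eq_2)
    then show ?thesis using central by auto
  next
    case 2
    then have "A [^]\<^bsub>SL_2_5\<^esub> (3::nat) = ?l 0 1"
      using pow[THEN pow_Suc] by (simp add: numeral_3_eq_3)
    then show ?thesis using central by auto
  next
    case 3
    then have "A [^]\<^bsub>SL_2_5\<^esub> (5::nat) = ?l 0 (-1)"
      using pow[THEN pow_Suc, THEN pow_Suc, THEN pow_Suc] by (simp add: eval_nat_numeral mod_5)
    then show ?thesis using central by auto
  next
    case 4
    then have "A [^]\<^bsub>SL_2_5\<^esub> (5::nat) = ?l 0 1"
      using pow[THEN pow_Suc, THEN pow_Suc, THEN pow_Suc] by (simp add: eval_nat_numeral mod_5)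
    then show ?thesis using central by auto
  next
    case 5
    then have "A [^]\<^bsub>SL_2_5\<^esub> (3::nat) = ?l 0 (-1)"
      using pow[THEN pow_Suc] by (simp add: numeral_3_eq_3)
    then show ?thesis using central by auto
  qed
qed

theorem order_PSL_2_5: "Coset.order PSL_2_5 = 60"
proof -
  interpret SL: group SL_2_5 by (rule group_SL_2)
  have "subgroup (group_center SL_2_5) SL_2_5"
    using SL.group_center_normal by (rule normal_imp_subgroup)
  then have "card (rcosets\<^bsub>SL_2_5\<^esub> (group_center SL_2_5)) * card (group_center SL_2_5) = 120"
    using SL.lagrange order_SL_2_5 by simp
  moreover have "card (group_center SL_2_5) = 2"
    by (simp add: group_center_SL_2_5 mat2_eq_iff)
  ultimately show ?thesis
    by (simp add: Coset.order_def PSL_def FactGroup_def)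
qed

text \<open>A central n-th power becomes trivial in the quotient, so every order divides one of the
  primes 2, 3, 5.\<close>

lemma order_60_prime_ords_PSL_2_5: "order_60_prime_ords PSL_2_5"
proof -
  interpret SL: group SL_2_5 by (rule group_SL_2)
  interpret Z: normal "group_center SL_2_5" SL_2_5 by (rule SL.group_center_normal)
  interpret PSL: group PSL_2_5 unfolding PSL_def by (rule Z.factorgroup_is_group)
  show ?thesis
  proof
    show "Coset.order PSL_2_5 = 60" by (rule order_PSL_2_5)
  next
    fix C assume "C \<in> carrier PSL_2_5"
    then obtain A where A: "A \<in> carrier SL_2_5" "C = group_center SL_2_5 #>\<^bsub>SL_2_5\<^esub> A"
      by (auto simp: PSL_def FactGroup_def RCOSETS_def)
    obtain n :: nat where n: "n \<in> {2, 3, 5}" "A [^]\<^bsub>SL_2_5\<^esub> n \<in> group_center SL_2_5"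
      using SL_2_5_power_central[OF A(1)] by blast
    have "PSL.ord C dvd n"
      using Z.ord_Mod_dvd[OF A(1) n(2)] by (simp add: A(2) PSL_def)
    moreover have "Factorial_Ring.prime n" using n(1) by auto
    ultimately have "PSL.ord C = 1 \<or> PSL.ord C = n" by (simp add: prime_nat_iff)
    then show "PSL.ord C \<in> {1, 2, 3, 5}" using n(1) by auto
  qed
qed

lemma (in order_60_prime_ords) Exp_rho_eq_15_20_24: "Exp_rho G = {15, 20, 24}"
proof -
  have "prime_factors (60::nat) = {2, 3, 5}"
  proof -
    have "prime_factors (2 * (2 * (3 * 5)) :: nat) = {2, 3, 5}"
      by (subst prime_factors_product, simp, simp)+ (auto simp: prime_prime_factors)
    then show ?thesis by simp
  qed
  then show ?thesis
    by (simp add: Exp_rho_eq[OF fin] order_60 exponent_sums)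
qed

theorem theorem2p9:
  fixes G :: "('a, 'b) monoid_scheme"
  assumes "group G" and "finite (carrier G)"
  shows "(G \<cong> PSL_2_5 \<or> G \<cong> integer_mod_group 30) \<longleftrightarrow> Exp_rho G = Exp_rho PSL_2_5"
proof -
  interpret group G by fact
  note fin = assms(2)
  interpret PSL: order_60_prime_ords PSL_2_5 by (rule order_60_prime_ords_PSL_2_5)
  note PSL_exps = PSL.Exp_rho_eq_15_20_24
  show ?thesis
  proof
    assume "G \<cong> PSL_2_5 \<or> G \<cong> integer_mod_group 30"
    then show "Exp_rho G = Exp_rho PSL_2_5"
    proof
      assume "G \<cong> PSL_2_5"
      then show ?thesis by (rule Exp_rho_iso[OF assms(1) PSL.group_axioms])
    next
      assume "G \<cong> integer_mod_group 30"
      then have "Exp_rho G = Exp_rho (integer_mod_group 30)"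
        by (rule Exp_rho_iso[OF assms(1) group_integer_mod_group])
      then show ?thesis by (simp only: Exp_rho_integer_mod_group_30 PSL_exps)
    qed
  next
    assume "Exp_rho G = Exp_rho PSL_2_5"
    then have E: "Exp_rho G = {15, 20, 24}" by (simp only: PSL_exps)
    note e = Exp_rho_15_20_24(2-4)[OF fin E]
    have "Coset.order G = 30 \<or> Coset.order G = 60"
      using Exp_rho_15_20_24(1)[OF fin E] by simp
    then show "G \<cong> PSL_2_5 \<or> G \<cong> integer_mod_group 30"
    proof
      assume "Coset.order G = 30"
      then show ?thesis using order_30_cyclic e by blast
    next
      assume n: "Coset.order G = 60"
      interpret G: order_60_prime_ords G
        using n prime_ords_of_exponent_sums[OF n e] by unfold_locales
      have "G \<cong> alt_group 5" "alt_group 5 \<cong> PSL_2_5"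
        using G.iso_alt_group_5 PSL.iso_sym[OF PSL.iso_alt_group_5] by auto
      then show ?thesis using iso_trans by blast
    qed
  qed
qed

end
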